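(* Let $\mathbf p=(p_1,\dots,p_n)$ with $p_i\in(1,\infty)$, let $1\le j\le n$, $s_{j+1},\dots,s_n\in(0,1)$ fixed, and for $k\in\mathbb N$ let $\mathbf s_k=(s^k_1,\dots,s^k_j,s_{j+1},\dots,s_n)$ with $s^k_i\in(0,1)$ and $s^k_i\to1$ as $k\to\infty$ for $i=1,\dots,j$, so that $\mathbf s_k\to\mathbf s_0=(1,\dots,1,s_{j+1},\dots,s_n)$ ($j$ ones). Let $\{u_k\}\subset L^{p_{\min}}(\mathbb R^n)\cap L^{p_{\max}}(\mathbb R^n)$ satisfy $$\sup_k\left(\|u_k\|_{p_{\max}}+\|u_k\|_{p_{\min}}\right)<\infty,\qquad \sup_k J_{\mathbf s_k,\mathbf p}(u_k)<\infty.$$ If $\overline{\mathbf s_0\mathbf p}<n$ and $p_{\max}<\mathbf p^*_{\mathbf s_0}$, then there exist a subsequence $\{u_{k_m}\}_{m\in\mathbb N}$ and a function $u$ such that $u_{k_m}\to u$ in $L^{p_{\max}}_{\mathrm{loc}}(\mathbb R^n)$ as $m\to\infty$.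
   Context: For $i\in\{1,\dots,n\}$, $s\in(0,1]$, $p\in(1,\infty)$, with $e_i$ the $i$-th basis vector: $J^i_{s,p}(u)=s(1-s)\int_{\mathbb R^n}\int_{\mathbb R}\frac{|u(x+he_i)-u(x)|^p}{|h|^{1+sp}}dh\,dx$ if $s<1$, and $J^i_{1,p}(u)=\frac2p\int|\partial_{x_i}u|^p dx$ (distributional derivative; $+\infty$ if not in $L^p$). For $\mathbf s=(s_1,\dots,s_n)\in(0,1]^n$: $J_{\mathbf s,\mathbf p}(u)=\sum_{i=1}^n\frac1{p_i}J^i_{s_i,p_i}(u)$. $p_{\min}=\min_ip_i$, $p_{\max}=\max_ip_i$. $\bar{\mathbf s}=(\frac1n\sum_i1/s_i)^{-1}$, $\overline{\mathbf s\mathbf p}=(\frac1n\sum_i1/(s_ip_i))^{-1}$, and when $\overline{\mathbf s\mathbf p}<n$, $\mathbf p^*_{\mathbf s}=\frac{n\overline{\mathbf s\mathbf p}/\bar{\mathbf s}}{n-\overline{\mathbf s\mathbf p}}$. *)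

theory Defs
  imports "HOL-Analysis.Analysis"
begin

definition J_frac :: "'n::finite \<Rightarrow> real \<Rightarrow> real \<Rightarrow> (real^'n \<Rightarrow> real) \<Rightarrow> ennreal" where
  "J_frac i s p u =
     ennreal (s * (1 - s)) *
     (\<integral>\<^sup>+ x. (\<integral>\<^sup>+ h. ennreal (\<bar>u (x + h *\<^sub>R axis i 1) - u x\<bar> powr p
                             / \<bar>h\<bar> powr (1 + s * p)) \<partial>lborel) \<partial>lborel)"

definition J_aniso :: "('n::finite \<Rightarrow> real) \<Rightarrow> ('n \<Rightarrow> real) \<Rightarrow> (real^'n \<Rightarrow> real) \<Rightarrow> ennreal" where
  "J_aniso s p u = (\<Sum>i\<in>UNIV. ennreal (1 / p i) * J_frac i (s i) (p i) u)"

text \<open>L^p norm (for u with |u|^p integrable).\<close>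
definition Lp_norm :: "real \<Rightarrow> (real^'n::finite \<Rightarrow> real) \<Rightarrow> real" where
  "Lp_norm p u = (\<integral> x. \<bar>u x\<bar> powr p \<partial>lborel) powr (1 / p)"

definition in_Lp :: "real \<Rightarrow> (real^'n::finite \<Rightarrow> real) \<Rightarrow> bool" where
  "in_Lp p u \<longleftrightarrow> u \<in> borel_measurable lborel \<and> integrable lborel (\<lambda>x. \<bar>u x\<bar> powr p)"

definition p_min :: "('n::finite \<Rightarrow> real) \<Rightarrow> real" where
  "p_min p = Min (range p)"

definition p_max :: "('n::finite \<Rightarrow> real) \<Rightarrow> real" where
  "p_max p = Max (range p)"

definition s_bar :: "('n::finite \<Rightarrow> real) \<Rightarrow> real" where
  "s_bar s = inverse ((1 / real CARD('n)) * (\<Sum>i\<in>UNIV. 1 / s i))"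

definition sp_bar :: "('n::finite \<Rightarrow> real) \<Rightarrow> ('n \<Rightarrow> real) \<Rightarrow> real" where
  "sp_bar s p = inverse ((1 / real CARD('n)) * (\<Sum>i\<in>UNIV. 1 / (s i * p i)))"

text \<open>Critical exponent p*_s = (n * bar(sp)/bar s) / (n - bar(sp)) (meaningful when bar(sp) < n).\<close>
definition p_star :: "('n::finite \<Rightarrow> real) \<Rightarrow> ('n \<Rightarrow> real) \<Rightarrow> real" where
  "p_star s p = (real CARD('n) * sp_bar s p / s_bar s) / (real CARD('n) - sp_bar s p)"

definition Lp_loc_converges ::
    "real \<Rightarrow> (nat \<Rightarrow> real^'n::finite \<Rightarrow> real) \<Rightarrow> (real^'n \<Rightarrow> real) \<Rightarrow> bool" where
  "Lp_loc_converges q f g \<longleftrightarrow>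
     g \<in> borel_measurable lborel \<and>
     (\<forall>K. compact K \<longrightarrow>
        set_integrable lborel K (\<lambda>x. \<bar>g x\<bar> powr q) \<and>
        (\<forall>m. set_integrable lborel K (\<lambda>x. \<bar>f m x - g x\<bar> powr q)) \<and>
        ((\<lambda>m. (LINT x:K|lborel. \<bar>f m x - g x\<bar> powr q) powr (1 / q)) \<longlonglongrightarrow> 0))"

end

theory Submission
  imports Defs "HOL-Complex_Analysis.Great_Picard"
begin

text \<open>
  Let \<open>q\<close> be the largest exponent. That \<open>q\<close> is below the critical exponent means that
  \<open>\<Sum>i. (1 / \<sigma> i) * (1 / p i - 1 / q) < 1\<close> for suitable \<open>\<sigma> i\<close> slightly below \<open>s0 i\<close>.
  Thanks to the factor \<open>1 - s\<close> in the seminorms, the differences with step \<open>t\<close> in direction \<open>i\<close>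
  are bounded by \<open>C * \<bar>t\<bar> powr \<sigma> i\<close> in \<open>L\<close> with exponent \<open>p i\<close>, uniformly in \<open>k\<close>.
  Averaging over an anisotropic box of volume \<open>2 powr (- m)\<close> with sides \<open>2 powr (- m * a i)\<close>
  maps exponent \<open>p i\<close> to exponent \<open>q\<close> with norm \<open>2 powr (m * (1 / p i - 1 / q))\<close>. Hence the
  averages at scales \<open>m\<close> and \<open>m + 1\<close> differ by \<open>O(2 powr (- \<epsilon> * m))\<close> in \<open>L\<close> with exponent \<open>q\<close>
  as soon as \<open>a i * \<sigma> i - (1 / p i - 1 / q) \<ge> \<epsilon> > 0\<close> for all \<open>i\<close>, and such \<open>a\<close> with sum \<open>1\<close> exist
  exactly under the condition above. So the functions are approximated, uniformly in \<open>k\<close>, by their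
  averages at scale \<open>m\<close>, which are equibounded and equicontinuous; a diagonal argument concludes.
\<close>

subsection \<open>Power integrals\<close>

text \<open>Neither an embedding into the critical space nor interpolation is used. The orders
  \<open>s k i\<close> move with k, so every bound is stated at one fixed order
  \<open>\<sigma> i\<close>, at most \<open>s k i\<close> for all but finitely many k, with
  constants free of k. A second obstacle is that the exponents \<open>p i\<close> differ between
  directions: differences along different axes lie in different Lebesgue spaces. They are added only
  after an average has lifted them to the common exponent \<open>q\<close>, or as first powers at
  almost every point. The telescoped error is small in exponent \<open>q\<close> on the whole space.
  Compact sets matter only for the limit in k at a fixed scale, where uniformly bounded functions
  are integrated over a set of finite measure.\<close>

lemma powr_convex_combination:
  fixes p a b x y :: real
  assumes "1 \<le> p" "0 \<le> a" "0 \<le> b" "a + b = 1" "0 \<le> x" "0 \<le> y"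
  shows "(a * x + b * y) powr p \<le> a * x powr p + b * y powr p"
proof -
  \<comment> \<open>Convexity is applied at positive arguments. If one argument is zero, the claim
    reduces to this inequality, which rests on \<open>c powr p \<le> c\<close> for weights up to
    1.\<close>
  have scale: "(c * z) powr p \<le> c * z powr p" if "0 \<le> c" "c \<le> 1" "0 \<le> z" for c z :: real
  proof -
    have "c powr p \<le> c"
      using that assms powr_mono'[of 1 p c] by (cases "c = 0") auto
    then show ?thesis
      using that by (simp add: powr_mult mult_right_mono)
  qed
  consider "x = 0" | "y = 0" | "0 < x" "0 < y"
    using assms by fastforce
  then show ?thesis
  proof cases
    case 3
    then show ?thesis
      using powr_convex[OF \<open>1 \<le> p\<close>] assms by (auto simp: convex_on_def)
  qed (use scale[of b y] scale[of a x] assms in auto)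
qed

lemma abs_add_powr_le:
  fixes p x y :: real
  assumes "1 \<le> p"
  shows "\<bar>x + y\<bar> powr p \<le> 2 powr (p - 1) * (\<bar>x\<bar> powr p + \<bar>y\<bar> powr p)"
proof -
  have "\<bar>x + y\<bar> powr p \<le> (2 * (1/2 * \<bar>x\<bar> + 1/2 * \<bar>y\<bar>)) powr p"
    using assms by (intro powr_mono2) auto
  also have "\<dots> = 2 powr p * (1/2 * \<bar>x\<bar> + 1/2 * \<bar>y\<bar>) powr p"
    by (rule powr_mult)
  also have "\<dots> \<le> 2 powr p * (1/2 * \<bar>x\<bar> powr p + 1/2 * \<bar>y\<bar> powr p)"
    using powr_convex_combination[OF assms, of "1/2" "1/2" "\<bar>x\<bar>" "\<bar>y\<bar>"]
    by (intro mult_left_mono) auto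
  also have "\<dots> = 2 powr (p - 1) * (\<bar>x\<bar> powr p + \<bar>y\<bar> powr p)"
    by (simp add: powr_diff field_simps)
  finally show ?thesis .
qed

text \<open>The tangent at \<open>a\<close> to the convex function t^p stays below it. Being affine
  in \<open>t\<close>, the bound can be integrated against a probability measure.\<close>

lemma Young_tangent:
  fixes p a t :: real
  assumes "1 \<le> p" "0 \<le> a" "0 \<le> t"
  shows "p * a powr (p - 1) * t \<le> t powr p + (p - 1) * a powr p"
proof (cases "a = 0 \<or> t = 0")
  case True
  then show ?thesis using assms by auto
next
  case False
  then have pos: "0 < a" "0 < t" using assms by auto
  have "(t powr p) powr (1/p) * (a powr p) powr (1 - 1/p) \<le> 1/p * t powr p + (1 - 1/p) * a powr p"
    using pos assms by (intro Youngs_inequality_0) (auto simp: field_simps)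
  moreover have "(t powr p) powr (1/p) * (a powr p) powr (1 - 1/p) = a powr (p - 1) * t"
    using pos assms by (simp add: powr_powr algebra_simps)
  ultimately have "p * (a powr (p - 1) * t) \<le> p * (1/p * t powr p + (1 - 1/p) * a powr p)"
    using assms by (intro mult_left_mono) auto
  also have "\<dots> = t powr p + (p - 1) * a powr p"
    using assms by (simp add: field_simps)
  finally show ?thesis by (simp add: mult.assoc)
qed

text \<open>Values up to \<open>r\<close> are absorbed by \<open>r\<close>; larger ones gain from
  the decreasing factor \<open>\<bar>t\<bar> powr (1 - p)\<close>. Letting \<open>r\<close> run
  through a geometric sequence turns decay of p-th powers into summability of first powers.\<close>

lemma abs_le_add_powr:
  fixes p r t :: real
  assumes "1 \<le> p" "0 < r"
  shows "\<bar>t\<bar> \<le> r + r powr (1 - p) * \<bar>t\<bar> powr p"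
proof (cases "\<bar>t\<bar> \<le> r")
  case True
  have "0 \<le> r powr (1 - p) * \<bar>t\<bar> powr p" by simp
  with True show ?thesis by linarith
next
  case False
  have "\<bar>t\<bar> = \<bar>t\<bar> powr (1 - p) * \<bar>t\<bar> powr p"
    using False assms by (simp flip: powr_add)
  also have "\<dots> \<le> r powr (1 - p) * \<bar>t\<bar> powr p"
    using False assms by (intro mult_right_mono powr_mono2') auto
  finally show ?thesis using assms by linarith
qed

lemma Jensen_powr:
  fixes f :: "'a \<Rightarrow> real"
  assumes "emeasure M (space M) = 1" "integrable M f" "1 \<le> p"
  shows "ennreal (\<bar>\<integral>x. f x \<partial>M\<bar> powr p) \<le> (\<integral>\<^sup>+x. ennreal (\<bar>f x\<bar> powr p) \<partial>M)"
proof (cases "(\<integral>\<^sup>+x. ennreal (\<bar>f x\<bar> powr p) \<partial>M) = \<infinity>")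
  case False
  interpret finite_measure M
    by standard (use assms in auto)
  define a where "a = (\<integral>x. \<bar>f x\<bar> \<partial>M)"
  have a: "0 \<le> a" "\<bar>\<integral>x. f x \<partial>M\<bar> \<le> a"
    unfolding a_def by (auto intro: integral_abs_bound)
  have [measurable]: "f \<in> borel_measurable M" using assms by auto
  have int: "integrable M (\<lambda>x. \<bar>f x\<bar> powr p)"
    using False by (intro integrableI_bounded) (auto simp: top.not_eq_extremum)
  have "measure M (space M) = 1"
    using assms by (simp add: measure_def)
  \<comment> \<open>The tangent inequality at the mean \<open>a\<close> of the absolute values is
    integrated; cancelling \<open>(p - 1) * a powr p\<close> leaves Jensen's inequality.\<close>
  then have "p * a powr (p - 1) * a \<le> (\<integral>x. \<bar>f x\<bar> powr p \<partial>M) + (p - 1) * a powr p"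
    using integral_mono[of M "\<lambda>x. p * a powr (p - 1) * \<bar>f x\<bar>" "\<lambda>x. \<bar>f x\<bar> powr p + (p - 1) * a powr p"]
      Young_tangent[OF assms(3) a(1)] int assms(2)
    by (simp add: a_def[symmetric])
  moreover have "p * a powr (p - 1) * a = p * a powr p"
    using a by (cases "a = 0") (auto simp: powr_diff)
  ultimately have "p * a powr p \<le> (\<integral>x. \<bar>f x\<bar> powr p \<partial>M) + (p - 1) * a powr p"
    by simp
  then have "a powr p \<le> (\<integral>x. \<bar>f x\<bar> powr p \<partial>M)"
    by (simp add: left_diff_distrib)
  moreover have "\<bar>\<integral>x. f x \<partial>M\<bar> powr p \<le> a powr p"
    using a assms by (intro powr_mono2) auto
  ultimately have "ennreal (\<bar>\<integral>x. f x \<partial>M\<bar> powr p) \<le> ennreal (\<integral>x. \<bar>f x\<bar> powr p \<partial>M)"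
    by (intro ennreal_leI) linarith
  also have "\<dots> = (\<integral>\<^sup>+x. ennreal (\<bar>f x\<bar> powr p) \<partial>M)"
    using int by (intro nn_integral_eq_integral[symmetric]) auto
  finally show ?thesis .
qed auto

text \<open>A norm bound by \<open>a\<close> is written
  \<open>pow_int p f \<le> ennreal (a powr p)\<close>: the extended values make finiteness part of
  the bound, and p-th roots are avoided.\<close>

definition pow_int :: "real \<Rightarrow> ('a::euclidean_space \<Rightarrow> real) \<Rightarrow> ennreal" where
  "pow_int p f = (\<integral>\<^sup>+x. ennreal (\<bar>f x\<bar> powr p) \<partial>lborel)"

lemma pow_int_cong_AE:
  "AE x in lborel. f x = g x \<Longrightarrow> pow_int p f = pow_int p g"
  unfolding pow_int_def by (intro nn_integral_cong_AE) auto

lemma pow_int_minus: "pow_int p (\<lambda>x. f x - g x) = pow_int p (\<lambda>x. g x - f x)"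
  unfolding pow_int_def by (simp add: abs_minus_commute)

lemma pow_int_eq_0_AE:
  assumes [measurable]: "f \<in> borel_measurable borel" and "pow_int p f = 0"
  shows "AE x in lborel. f x = 0"
proof -
  have "AE x in lborel. ennreal (\<bar>f x\<bar> powr p) = 0"
    using assms(2) by (subst nn_integral_0_iff_AE[symmetric]) (auto simp: pow_int_def)
  then show ?thesis by eventually_elim (auto simp: ennreal_eq_0_iff)
qed

text \<open>Convexity of the power with weights a / (a + b) and b / (a + b), applied to the
  normalised functions f / a and g / b. A vanishing bound forbids the normalisation, but then the
  function is zero almost everywhere.\<close>

lemma Minkowski_pow_int:
  fixes f g :: "'a::euclidean_space \<Rightarrow> real"
  assumes [measurable]: "f \<in> borel_measurable borel" "g \<in> borel_measurable borel"
    and p: "1 \<le> p" and a: "0 \<le> a" and b: "0 \<le> b"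
    and f: "pow_int p f \<le> ennreal (a powr p)" and g: "pow_int p g \<le> ennreal (b powr p)"
  shows "pow_int p (\<lambda>x. f x + g x) \<le> ennreal ((a + b) powr p)"
proof -
  consider "a = 0" | "b = 0" | "0 < a" "0 < b" using a b by fastforce
  then show ?thesis
  proof cases
    case 1
    then have "AE x in lborel. f x = 0"
      using f p by (intro pow_int_eq_0_AE[of f p]) auto
    then have "pow_int p (\<lambda>x. f x + g x) = pow_int p g"
      by (intro pow_int_cong_AE) auto
    with 1 g show ?thesis by simp
  next
    case 2
    then have "AE x in lborel. g x = 0"
      using g p by (intro pow_int_eq_0_AE[of g p]) auto
    then have "pow_int p (\<lambda>x. f x + g x) = pow_int p f"
      by (intro pow_int_cong_AE) auto
    with 2 f show ?thesis by simp
  next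
    case 3
    define c where "c = a + b"
    have c: "0 < c" using 3 by (simp add: c_def)
    define \<alpha> where "\<alpha> = c powr p * (a / c) / a powr p"
    define \<beta> where "\<beta> = c powr p * (b / c) / b powr p"
    have pos: "0 \<le> \<alpha>" "0 \<le> \<beta>" using 3 c by (auto simp: \<alpha>_def \<beta>_def)
    have pt: "\<bar>f x + g x\<bar> powr p \<le> \<alpha> * \<bar>f x\<bar> powr p + \<beta> * \<bar>g x\<bar> powr p" for x
    proof -
      have "\<bar>f x + g x\<bar> powr p \<le> (c * (a / c * (\<bar>f x\<bar> / a) + b / c * (\<bar>g x\<bar> / b))) powr p"
        using p 3 c by (intro powr_mono2) (auto simp: distrib_left)
      also have "\<dots> = c powr p * (a / c * (\<bar>f x\<bar> / a) + b / c * (\<bar>g x\<bar> / b)) powr p"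
        by (rule powr_mult)
      also have "\<dots> \<le> c powr p * (a / c * (\<bar>f x\<bar> / a) powr p + b / c * (\<bar>g x\<bar> / b) powr p)"
        using p 3 c by (intro mult_left_mono powr_convex_combination) (auto simp: c_def add_divide_distrib[symmetric])
      also have "\<dots> = \<alpha> * \<bar>f x\<bar> powr p + \<beta> * \<bar>g x\<bar> powr p"
        using 3 by (simp add: \<alpha>_def \<beta>_def powr_divide algebra_simps)
      finally show ?thesis .
    qed
    have "pow_int p (\<lambda>x. f x + g x) \<le> (\<integral>\<^sup>+x. ennreal \<alpha> * ennreal (\<bar>f x\<bar> powr p) + ennreal \<beta> * ennreal (\<bar>g x\<bar> powr p) \<partial>lborel)"
      unfolding pow_int_def using pt pos
      by (intro nn_integral_mono) (simp flip: ennreal_mult ennreal_plus)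
    also have "\<dots> = ennreal \<alpha> * pow_int p f + ennreal \<beta> * pow_int p g"
      by (simp add: pow_int_def nn_integral_add nn_integral_cmult)
    also have "\<dots> \<le> ennreal \<alpha> * ennreal (a powr p) + ennreal \<beta> * ennreal (b powr p)"
      by (intro add_mono mult_left_mono f g) auto
    also have "\<dots> = ennreal (\<alpha> * a powr p + \<beta> * b powr p)"
      using pos by (simp flip: ennreal_mult ennreal_plus)
    also have "\<alpha> * a powr p + \<beta> * b powr p = (a + b) powr p"
    proof -
      have "\<alpha> * a powr p + \<beta> * b powr p = c powr p * ((a + b) / c)"
        using 3 by (simp add: \<alpha>_def \<beta>_def add_divide_distrib distrib_left)
      then show ?thesis using c by (simp add: c_def)
    qed
    finally show ?thesis .
  qed
qed

lemma Minkowski_pow_int_sum: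
  fixes f :: "'i \<Rightarrow> 'a::euclidean_space \<Rightarrow> real"
  assumes "finite I" and "\<And>i. i \<in> I \<Longrightarrow> f i \<in> borel_measurable borel"
    and p: "1 \<le> p" and "\<And>i. i \<in> I \<Longrightarrow> 0 \<le> a i"
    and "\<And>i. i \<in> I \<Longrightarrow> pow_int p (f i) \<le> ennreal (a i powr p)"
  shows "pow_int p (\<lambda>x. \<Sum>i\<in>I. f i x) \<le> ennreal ((\<Sum>i\<in>I. a i) powr p)"
  using assms(1,2,4,5)
proof (induction I)
  case empty
  then show ?case by (simp add: pow_int_def)
next
  case (insert i I)
  then show ?case
    using Minkowski_pow_int[of "f i" "\<lambda>x. \<Sum>i\<in>I. f i x" p "a i" "sum a I"] p
    by (simp add: sum_nonneg)
qed

lemma nn_integral_translate: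
  fixes g :: "'a::euclidean_space \<Rightarrow> ennreal"
  assumes [measurable]: "g \<in> borel_measurable borel"
  shows "(\<integral>\<^sup>+x. g (x + c) \<partial>lborel) = (\<integral>\<^sup>+x. g x \<partial>lborel)"
proof -
  have "(\<integral>\<^sup>+x. g x \<partial>lborel) = (\<integral>\<^sup>+x. g x \<partial>distr lborel borel ((+) c))"
    by (simp add: lborel_distr_plus)
  also have "\<dots> = (\<integral>\<^sup>+x. g (x + c) \<partial>lborel)"
    by (subst nn_integral_distr) (auto simp: add.commute)
  finally show ?thesis by simp
qed

lemma pow_int_translate:
  assumes [measurable]: "f \<in> borel_measurable borel"
  shows "pow_int p (\<lambda>x. f (x + c)) = pow_int p f"
  unfolding pow_int_def by (rule nn_integral_translate[of "\<lambda>x. ennreal (\<bar>f x\<bar> powr p)"]) simp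

subsection \<open>Differences controlled by the fractional seminorm\<close>

lemma pow_int_difference_add:
  fixes u :: "'a::euclidean_space \<Rightarrow> real"
  assumes [measurable]: "u \<in> borel_measurable borel" and p: "1 \<le> p"
  shows "pow_int p (\<lambda>x. u (x + (a + b)) - u x)
    \<le> ennreal (2 powr (p - 1)) * (pow_int p (\<lambda>x. u (x + a) - u x) + pow_int p (\<lambda>x. u (x + b) - u x))"
proof -
  have "pow_int p (\<lambda>x. u (x + (a + b)) - u x) \<le>
    (\<integral>\<^sup>+x. ennreal (2 powr (p - 1)) *
      (ennreal (\<bar>u (x + a + b) - u (x + a)\<bar> powr p) + ennreal (\<bar>u (x + a) - u x\<bar> powr p)) \<partial>lborel)"
    unfolding pow_int_def
  proof (rule nn_integral_mono)
    fix x
    show "ennreal (\<bar>u (x + (a + b)) - u x\<bar> powr p) \<le> ennreal (2 powr (p - 1)) *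
      (ennreal (\<bar>u (x + a + b) - u (x + a)\<bar> powr p) + ennreal (\<bar>u (x + a) - u x\<bar> powr p))"
      using abs_add_powr_le[OF p, of "u (x + a + b) - u (x + a)" "u (x + a) - u x"]
      by (simp add: add.assoc flip: ennreal_plus ennreal_mult)
  qed
  also have "\<dots> = ennreal (2 powr (p - 1)) *
      (pow_int p (\<lambda>x. u (x + a + b) - u (x + a)) + pow_int p (\<lambda>x. u (x + a) - u x))"
    by (simp add: pow_int_def nn_integral_cmult nn_integral_add)
  also have "pow_int p (\<lambda>x. u (x + a + b) - u (x + a)) = pow_int p (\<lambda>x. u (x + b) - u x)"
    using pow_int_translate[of "\<lambda>x. u (x + b) - u x" p a] by simp
  finally show ?thesis by (simp add: add.commute)
qed

lemma pow_int_difference_uminus: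
  fixes u :: "'a::euclidean_space \<Rightarrow> real"
  assumes [measurable]: "u \<in> borel_measurable borel"
  shows "pow_int p (\<lambda>x. u (x - a) - u x) = pow_int p (\<lambda>x. u (x + a) - u x)"
  using pow_int_translate[of "\<lambda>x. u (x - a) - u x" p a] by (simp add: pow_int_minus[of _ u])

text \<open>The convexity constant \<open>2 powr (p - 1)\<close> makes the cost of a halving exactly
  \<open>2 powr p\<close>. A larger cost would spoil the ratio
  \<open>2 powr (- (p * (1 - s)))\<close> of the later geometric series, on which the cancellation
  of \<open>1 - s\<close> depends.\<close>

lemma pow_int_difference_halve:
  fixes u :: "'a::euclidean_space \<Rightarrow> real"
  assumes [measurable]: "u \<in> borel_measurable borel" and p: "1 \<le> p"
  shows "pow_int p (\<lambda>x. u (x + t *\<^sub>R e) - u x)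
    \<le> ennreal (2 powr (real k * p)) * pow_int p (\<lambda>x. u (x + (t / 2 ^ k) *\<^sub>R e) - u x)"
proof (induction k)
  case (Suc k)
  define W where "W t = pow_int p (\<lambda>x. u (x + t *\<^sub>R e) - u x)" for t
  have "W (t / 2 ^ k) \<le> ennreal (2 powr (p - 1)) * (W (t / 2 ^ Suc k) + W (t / 2 ^ Suc k))"
    using pow_int_difference_add[OF assms, of "(t / 2 ^ Suc k) *\<^sub>R e" "(t / 2 ^ Suc k) *\<^sub>R e"]
    by (simp add: W_def flip: scaleR_add_left)
  also have "\<dots> = ennreal (2 powr (p - 1)) * (ennreal 2 * W (t / 2 ^ Suc k))"
    by (simp flip: mult_2)
  also have "\<dots> = ennreal (2 powr p) * W (t / 2 ^ Suc k)"
    by (simp only: mult.assoc[symmetric] ennreal_mult[symmetric] powr_ge_zero zero_le_numeral)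
       (simp add: powr_diff)
  finally have step: "W (t / 2 ^ k) \<le> ennreal (2 powr p) * W (t / 2 ^ Suc k)" .
  have "W t \<le> ennreal (2 powr (real k * p)) * W (t / 2 ^ k)"
    using Suc by (simp add: W_def)
  also have "\<dots> \<le> ennreal (2 powr (real k * p)) * (ennreal (2 powr p) * W (t / 2 ^ Suc k))"
    by (intro mult_left_mono step) simp
  also have "\<dots> = ennreal (2 powr (real (Suc k) * p)) * W (t / 2 ^ Suc k)"
    by (simp only: mult.assoc[symmetric] ennreal_mult[symmetric] powr_ge_zero)
       (simp add: powr_add[symmetric] algebra_simps)
  finally show ?case by (simp add: W_def)
qed simp

lemma pow_int_difference_measurable [measurable]:
  fixes u :: "'a::euclidean_space \<Rightarrow> real"
  assumes [measurable]: "u \<in> borel_measurable borel"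
  shows "(\<lambda>h::real. pow_int p (\<lambda>x. u (x + h *\<^sub>R e) - u x)) \<in> borel_measurable borel"
  unfolding pow_int_def by measurable

text \<open>Splits \<open>t\<close> into \<open>h\<close> and \<open>t - h\<close> and averages over
  the middle third. That third is symmetric about t / 2, so both summands contribute equally; its
  endpoints have ratio 2, so its half-open versions for the steps t / 2^k are disjoint.\<close>

lemma pow_int_difference_average:
  fixes u :: "'a::euclidean_space \<Rightarrow> real" and t :: real and e :: 'a
  assumes [measurable]: "u \<in> borel_measurable borel" and p: "1 \<le> p" and t: "0 < t"
  defines "W \<equiv> \<lambda>h::real. pow_int p (\<lambda>x. u (x + h *\<^sub>R e) - u x)"
  shows "ennreal (t / 3) * W t \<le> ennreal (2 powr p) * (\<integral>\<^sup>+h\<in>{t/3<..2*t/3}. W h \<partial>lborel)"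
proof -
  have [measurable]: "W \<in> borel_measurable borel"
    unfolding W_def by measurable
  \<comment> \<open>The open interval is invariant under h -> t - h, unlike the half-open one of the
    claim.\<close>
  define I where "I = {t/3<..<2*t/3}"
  have I[measurable]: "I \<in> sets borel" by (simp add: I_def)
  have "ennreal (t / 3) * W t = (\<integral>\<^sup>+h. W t * indicator I h \<partial>lborel)"
    using t by (simp add: nn_integral_cmult_indicator I_def mult.commute)
  also have "\<dots> \<le> (\<integral>\<^sup>+h. ennreal (2 powr (p - 1)) * (W h * indicator I h + W (t - h) * indicator I h) \<partial>lborel)"
  proof (rule nn_integral_mono)
    fix h
    have "W t \<le> ennreal (2 powr (p - 1)) * (W h + W (t - h))"
      using pow_int_difference_add[OF assms(1,2), of "h *\<^sub>R e" "(t - h) *\<^sub>R e"]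
      by (simp add: W_def flip: scaleR_add_left)
    then show "W t * indicator I h \<le> ennreal (2 powr (p - 1)) * (W h * indicator I h + W (t - h) * indicator I h)"
      by (auto simp: indicator_def)
  qed
  also have "\<dots> = ennreal (2 powr (p - 1)) * ((\<integral>\<^sup>+h\<in>I. W h \<partial>lborel) + (\<integral>\<^sup>+h\<in>I. W (t - h) \<partial>lborel))"
    by (simp add: nn_integral_cmult nn_integral_add)
  also have "(\<integral>\<^sup>+h\<in>I. W (t - h) \<partial>lborel) = (\<integral>\<^sup>+h\<in>I. W h \<partial>lborel)"
  proof -
    have "(\<integral>\<^sup>+h\<in>I. W h \<partial>lborel) = (\<integral>\<^sup>+h. W (t - h) * indicator I (t - h) \<partial>lborel)"
      using nn_integral_real_affine[of "\<lambda>h. W h * indicator I h" "-1" t] by simp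
    also have "\<dots> = (\<integral>\<^sup>+h\<in>I. W (t - h) \<partial>lborel)"
      by (intro nn_integral_cong) (auto simp: I_def indicator_def)
    finally show ?thesis by simp
  qed
  also have "ennreal (2 powr (p - 1)) * ((\<integral>\<^sup>+h\<in>I. W h \<partial>lborel) + (\<integral>\<^sup>+h\<in>I. W h \<partial>lborel))
    = ennreal (2 powr (p - 1)) * (ennreal 2 * (\<integral>\<^sup>+h\<in>I. W h \<partial>lborel))"
    by (simp flip: mult_2)
  also have "\<dots> = ennreal (2 powr p) * (\<integral>\<^sup>+h\<in>I. W h \<partial>lborel)"
    by (simp only: mult.assoc[symmetric] ennreal_mult[symmetric] powr_ge_zero zero_le_numeral)
       (simp add: powr_diff)
  also have "\<dots> \<le> ennreal (2 powr p) * (\<integral>\<^sup>+h\<in>{t/3<..2*t/3}. W h \<partial>lborel)"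
    by (intro mult_left_mono nn_integral_mono) (auto simp: I_def indicator_def)
  finally show ?thesis .
qed

text \<open>The series sums to 1 / (1 - 2^(-x)), and 1 - 2^(-x) is at most x. Taken at x = p (1 -
  s), it supplies the factor 1 / (1 - s) that the weight of the seminorm removes.\<close>

lemma geometric_powr_ge:
  assumes "0 < (x::real)"
  shows "ennreal (1 / x) \<le> (\<Sum>k. ennreal (2 powr (- real k * x)))"
proof -
  define q where "q = 2 powr (- x)"
  have q: "0 < q" "q < 1"
    using assms by (auto simp: q_def powr_minus field_simps)
  have "1 - x \<le> exp (- x)"
    using exp_ge_add_one_self[of "-x"] by simp
  also have "\<dots> \<le> exp (- x * ln 2)"
    using assms ln_2_less_1 by (simp)
  also have "\<dots> = q" by (simp add: q_def powr_def)
  finally have "1 - q \<le> x" by simp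
  then have "1 / x \<le> 1 / (1 - q)"
    using q assms by (simp add: frac_le)
  also have "\<dots> = (\<Sum>k. q ^ k)"
    using q by (simp add: suminf_geometric)
  finally have "ennreal (1 / x) \<le> ennreal (\<Sum>k. q ^ k)"
    by (rule ennreal_leI)
  also have "\<dots> = (\<Sum>k. ennreal (q ^ k))"
    using q by (intro suminf_ennreal_eq[symmetric]) (auto intro: summable_sums)
  also have "\<dots> = (\<Sum>k. ennreal (2 powr (- real k * x)))"
    by (simp add: q_def powr_realpow[symmetric] powr_powr mult.commute)
  finally show ?thesis .
qed

text \<open>The weight \<open>s (1 - s)\<close> in the seminorm compensates the divergence as \<open>s\<close> tends to \<open>1\<close>
  of the geometric series obtained by comparing the step \<open>t\<close> with all steps \<open>t / 2 ^ k\<close>;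
  so the constant stays bounded.\<close>

lemma J_frac_controls_difference:
  fixes u :: "real^'n::finite \<Rightarrow> real" and t :: real
  assumes [measurable]: "u \<in> borel_measurable borel" and p: "1 \<le> p"
    and s: "0 < s" "s < 1" and t: "0 < t"
  shows "pow_int p (\<lambda>x. u (x + t *\<^sub>R axis i 1) - u x)
    \<le> ennreal (2 powr (p + 2) * p / s * t powr (s * p)) * J_frac i s p u"
proof -
  define W where "W h = pow_int p (\<lambda>x. u (x + h *\<^sub>R axis i 1) - u x)" for h :: real
  have W[measurable]: "W \<in> borel_measurable borel"
    unfolding W_def by measurable
  define E where "E = 1 + s * p"
  have E: "1 < E" using s p by (simp add: E_def)
  define G where "G = (\<integral>\<^sup>+h. W h * ennreal (1 / \<bar>h\<bar> powr E) \<partial>lborel)"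
  have J: "J_frac i s p u = ennreal (s * (1 - s)) * G"
  proof -
    have "(\<integral>\<^sup>+x. (\<integral>\<^sup>+h. ennreal (\<bar>u (x + h *\<^sub>R axis i 1) - u x\<bar> powr p / \<bar>h\<bar> powr (1 + s * p)) \<partial>lborel) \<partial>lborel)
      = (\<integral>\<^sup>+h. (\<integral>\<^sup>+x. ennreal (\<bar>u (x + h *\<^sub>R axis i 1) - u x\<bar> powr p / \<bar>h\<bar> powr (1 + s * p)) \<partial>lborel) \<partial>lborel)"
      by (rule lborel_pair.Fubini') measurable
    also have "\<dots> = (\<integral>\<^sup>+h. (\<integral>\<^sup>+x. ennreal (\<bar>u (x + h *\<^sub>R axis i 1) - u x\<bar> powr p) * ennreal (1 / \<bar>h\<bar> powr E) \<partial>lborel) \<partial>lborel)"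
      by (simp add: E_def flip: ennreal_mult)
    also have "\<dots> = G"
      by (simp add: nn_integral_multc G_def W_def pow_int_def)
    finally show ?thesis by (simp add: J_frac_def)
  qed
  define A where "A k = {t / 2 ^ k / 3 <.. 2 * (t / 2 ^ k) / 3}" for k :: nat
  have A[measurable]: "A k \<in> sets borel" for k by (simp add: A_def)
  have disj: "disjoint_family A"
  proof -
    have less: "A k \<inter> A l = {}" if "k < l" for k l
    proof -
      have "(2::real) * 2 ^ k \<le> 2 ^ l"
        using that by (metis Suc_leI one_le_numeral power_Suc power_increasing)
      then have "2 * (t / 2 ^ l) / 3 \<le> t / 2 ^ k / 3"
        using t by (simp add: field_simps)
      then show ?thesis by (auto simp: A_def)
    qed
    show ?thesis
      unfolding disjoint_family_on_def using less by (metis Int_commute linorder_neqE_nat)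
  qed
  \<comment> \<open>The share of \<open>A k\<close>: going from step \<open>t\<close> to t / 2^k
    costs 2^(k p), the weight there is at least (t / 2^k)^(-E), and the length gives another t /
    2^k. Together they leave 2^(- k p (1 - s)).\<close>
  have piece: "ennreal (t powr (- s * p) / 2 powr (p + 2)) * W t * ennreal (2 powr (- real k * (p * (1 - s))))
     \<le> (\<integral>\<^sup>+h. (W h * ennreal (1 / \<bar>h\<bar> powr E)) * indicator (A k) h \<partial>lborel)" for k
  proof -
    define r where "r = t / 2 ^ k"
    have r: "0 < r" using t by (simp add: r_def)
    have "ennreal (r / 3) * W t \<le> ennreal (r / 3) * (ennreal (2 powr (real k * p)) * W r)"
      using pow_int_difference_halve[OF assms(1) p, of t "axis i 1" k]
      by (intro mult_left_mono) (auto simp: W_def r_def)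
    also have "\<dots> = ennreal (2 powr (real k * p)) * (ennreal (r / 3) * W r)"
      by (simp add: mult_ac)
    also have "\<dots> \<le> ennreal (2 powr (real k * p)) * (ennreal (2 powr p) * (\<integral>\<^sup>+h\<in>A k. W h \<partial>lborel))"
      using pow_int_difference_average[OF assms(1) p r, of "axis i 1"]
      by (intro mult_left_mono) (auto simp: W_def A_def r_def)
    also have "(\<integral>\<^sup>+h\<in>A k. W h \<partial>lborel) \<le>
      (\<integral>\<^sup>+h. ennreal (r powr E) * ((W h * ennreal (1 / \<bar>h\<bar> powr E)) * indicator (A k) h) \<partial>lborel)"
    proof (rule nn_integral_mono)
      fix h
      show "W h * indicator (A k) h \<le> ennreal (r powr E) * ((W h * ennreal (1 / \<bar>h\<bar> powr E)) * indicator (A k) h)"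
      proof (cases "h \<in> A k")
        case True
        then have h: "0 < h" "h \<le> r" using r by (auto simp: A_def r_def)
        have "1 \<le> r powr E * (1 / \<bar>h\<bar> powr E)"
          using h E by (simp add: powr_mono2)
        then have "W h * ennreal 1 \<le> W h * ennreal (r powr E * (1 / \<bar>h\<bar> powr E))"
          by (intro mult_left_mono ennreal_leI) auto
        then show ?thesis
          using True by (simp add: mult_ac flip: ennreal_mult)
      qed simp
    qed
    also have "\<dots> = ennreal (r powr E) * (\<integral>\<^sup>+h. (W h * ennreal (1 / \<bar>h\<bar> powr E)) * indicator (A k) h \<partial>lborel)"
      by (simp add: nn_integral_cmult)
    finally have main: "ennreal (r / 3) * W t \<le> ennreal (2 powr (real k * p)) * (ennreal (2 powr p) *
       (ennreal (r powr E) * (\<integral>\<^sup>+h. (W h * ennreal (1 / \<bar>h\<bar> powr E)) * indicator (A k) h \<partial>lborel)))"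
      (is "_ \<le> _ * (_ * (_ * ?I))")
      by (simp add: mult_left_mono)
    define c where "c = 2 powr (real k * p) * 2 powr p * r powr E"
    have c: "0 < c" using r by (simp add: c_def)
    have "ennreal (r / 3) * W t \<le> ennreal c * ?I"
      using main by (simp add: c_def ennreal_mult mult_ac)
    then have "ennreal (1 / c) * (ennreal (r / 3) * W t) \<le> ennreal (1 / c) * (ennreal c * ?I)"
      by (intro mult_left_mono) auto
    also have "\<dots> = ?I"
      using c by (simp add: mult.assoc[symmetric] ennreal_mult[symmetric])
    finally have 1: "ennreal (1 / c) * (ennreal (r / 3) * W t) \<le> ?I" .
    \<comment> \<open>The factor 1/3 from the length of the interval is weakened to 1/4, hence the
      exponent \<open>p + 2\<close>.\<close>
    have 2: "t powr (- s * p) / 2 powr (p + 2) * 2 powr (- real k * (p * (1 - s))) \<le> 1 / c * (r / 3)"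
    proof -
      have "2 powr (real k * p) * r powr (s * p) = t powr (s * p) * 2 powr (real k * (p * (1 - s)))"
        using t by (simp add: r_def powr_divide powr_realpow[symmetric] powr_powr powr_add[symmetric]
            powr_diff[symmetric] field_simps)
      then have eq: "1 / c * (r / 3) = 1 / (3 * 2 powr p * (t powr (s * p) * 2 powr (real k * (p * (1 - s)))))"
        using r t by (simp add: c_def E_def powr_add divide_simps)
      define a where "a = 2 powr (real k * (p * (1 - s)))"
      have inv: "2 powr (- real k * (p * (1 - s))) = 1 / a" "t powr (- s * p) = 1 / t powr (s * p)"
        and a: "0 < a"
        by (simp_all add: a_def powr_minus_divide)
      show ?thesis
        unfolding eq a_def[symmetric] inv using t a by (simp add: powr_add divide_simps)
    qed
    have "ennreal (t powr (- s * p) / 2 powr (p + 2)) * W t * ennreal (2 powr (- real k * (p * (1 - s))))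
      = ennreal (t powr (- s * p) / 2 powr (p + 2) * 2 powr (- real k * (p * (1 - s)))) * W t"
      by (subst ennreal_mult) (auto simp: mult_ac)
    also have "\<dots> \<le> ennreal (1 / c * (r / 3)) * W t"
      by (intro mult_right_mono ennreal_leI 2) auto
    also have "\<dots> = ennreal (1 / c) * (ennreal (r / 3) * W t)"
      using c r by (subst ennreal_mult) (auto simp: mult_ac)
    finally show ?thesis using 1 by (rule order_trans)
  qed
  define b where "b = t powr (- s * p) / 2 powr (p + 2)"
  have b: "0 < b" using t by (simp add: b_def)
  have ps: "0 < p * (1 - s)" using p s by simp
  have "ennreal b * W t * ennreal (1 / (p * (1 - s))) \<le> ennreal b * W t * (\<Sum>k. ennreal (2 powr (- real k * (p * (1 - s)))))"
    by (intro mult_left_mono geometric_powr_ge ps) simp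
  also have "\<dots> = (\<Sum>k. ennreal b * W t * ennreal (2 powr (- real k * (p * (1 - s)))))"
    by simp
  also have "\<dots> \<le> (\<Sum>k. \<integral>\<^sup>+h. (W h * ennreal (1 / \<bar>h\<bar> powr E)) * indicator (A k) h \<partial>lborel)"
    unfolding b_def by (intro suminf_le piece) auto
  also have "\<dots> = (\<integral>\<^sup>+h. (\<Sum>k. (W h * ennreal (1 / \<bar>h\<bar> powr E)) * indicator (A k) h) \<partial>lborel)"
    by (rule nn_integral_suminf[symmetric]) measurable
  also have "\<dots> \<le> G"
    unfolding G_def
  proof (rule nn_integral_mono)
    fix h
    show "(\<Sum>k. (W h * ennreal (1 / \<bar>h\<bar> powr E)) * indicator (A k) h) \<le> W h * ennreal (1 / \<bar>h\<bar> powr E)"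
    proof (cases "\<exists>k. h \<in> A k")
      case True
      then obtain k where "h \<in> A k" by blast
      from suminf_cmult_indicator[OF disj this, of "\<lambda>_. W h * ennreal (1 / \<bar>h\<bar> powr E)"]
      show ?thesis by simp
    qed simp
  qed
  finally have main: "ennreal b * W t * ennreal (1 / (p * (1 - s))) \<le> G" .
  define c where "c = b / (p * (1 - s))"
  have c: "0 < c" using b ps by (simp add: c_def)
  have "ennreal c = ennreal b * ennreal (1 / (p * (1 - s)))"
    using b ps by (subst ennreal_mult[symmetric]) (auto simp: c_def)
  then have main: "ennreal c * W t \<le> G"
    using main by (simp add: mult_ac)
  have "W t = ennreal (1 / c) * (ennreal c * W t)"
    using c by (simp add: mult.assoc[symmetric] ennreal_mult[symmetric])
  also have "\<dots> \<le> ennreal (1 / c) * G"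
    by (intro mult_left_mono main) simp
  also have "1 / c = 2 powr (p + 2) * p / s * t powr (s * p) * (s * (1 - s))"
    using t s p by (simp add: c_def b_def powr_minus field_simps)
  also have "ennreal \<dots> * G = ennreal (2 powr (p + 2) * p / s * t powr (s * p)) * J_frac i s p u"
    unfolding J using s p by (subst ennreal_mult) (auto simp: mult_ac)
  finally show ?thesis by (simp add: W_def)
qed

subsection \<open>Box averages\<close>

text \<open>Box averages become integrals of dilated arguments against this one probability measure,
  so Jensen's inequality and Tonelli's theorem apply at every scale to the same measure.\<close>

definition unit_cube_measure :: "(real^'n::finite) measure" where
  "unit_cube_measure = density lborel (indicator (cbox 0 1))"

lemma sets_unit_cube_measure [simp, measurable_cong]: "sets unit_cube_measure = sets borel"
  by (simp add: unit_cube_measure_def)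

lemma space_unit_cube_measure [simp]: "space unit_cube_measure = UNIV"
  by (simp add: unit_cube_measure_def)

lemma emeasure_unit_cube_measure [simp]:
  "emeasure (unit_cube_measure :: (real^'n::finite) measure) UNIV = 1"
proof -
  have "measure lborel (cbox 0 (1::real^'n)) = 1"
    by (subst content_cbox_cart) (auto simp: interval_ne_empty_cart)
  then have "emeasure lborel (cbox 0 (1::real^'n)) = 1"
    using emeasure_eq_ennreal_measure[of lborel "cbox 0 (1::real^'n)"]
      emeasure_lborel_cbox_finite[of 0 "1::real^'n"] by simp
  then show ?thesis
    by (simp add: unit_cube_measure_def emeasure_density)
qed

lemma AE_unit_cube_measure: "AE y in unit_cube_measure. y \<in> cbox 0 1"
  unfolding unit_cube_measure_def by (subst AE_density) (auto simp: indicator_def)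

interpretation unit_cube: finite_measure "unit_cube_measure :: (real^'n::finite) measure"
  by standard simp

interpretation unit_cube_pair: pair_sigma_finite
  "unit_cube_measure :: (real^'n::finite) measure" "unit_cube_measure :: (real^'n::finite) measure" ..

abbreviation cube_pair_measure :: "((real^'n::finite) \<times> (real^'n)) measure" where
  "cube_pair_measure \<equiv> unit_cube_measure \<Otimes>\<^sub>M unit_cube_measure"

lemma sets_cube_pair_measure:
  "sets (cube_pair_measure :: ((real^'n::finite) \<times> (real^'n)) measure) = sets borel"
  by (metis borel_prod sets_pair_measure_cong sets_unit_cube_measure)

lemma emeasure_cube_pair_measure [simp]:
  "emeasure (cube_pair_measure :: ((real^'n::finite) \<times> (real^'n)) measure) (space cube_pair_measure) = 1"
  using unit_cube.emeasure_pair_measure_Times[of UNIV "unit_cube_measure :: (real^'n) measure" UNIV]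
  by (simp add: space_pair_measure)

interpretation cube_pair: finite_measure "cube_pair_measure :: ((real^'n::finite) \<times> (real^'n)) measure"
  by standard simp

interpretation lborel_cube_pair: pair_sigma_finite "lborel :: (real^'n::finite) measure"
  "cube_pair_measure :: ((real^'n::finite) \<times> (real^'n)) measure" ..

lemma nn_integral_unit_cube_le:
  fixes f :: "real^'n::finite \<Rightarrow> ennreal"
  assumes "\<And>y. y \<in> cbox 0 1 \<Longrightarrow> f y \<le> B"
  shows "(\<integral>\<^sup>+y. f y \<partial>unit_cube_measure) \<le> B"
proof -
  have "(\<integral>\<^sup>+y. f y \<partial>unit_cube_measure) \<le> (\<integral>\<^sup>+y. B \<partial>(unit_cube_measure :: (real^'n) measure))"
    using AE_unit_cube_measure by (intro nn_integral_mono_AE) (auto intro: assms elim!: eventually_mono)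
  also have "\<dots> = B" by simp
  finally show ?thesis .
qed

lemma nn_integral_cube_pair_le:
  fixes f :: "(real^'n::finite) \<times> (real^'n) \<Rightarrow> ennreal"
  assumes [measurable]: "f \<in> borel_measurable borel"
    and "\<And>y z. y \<in> cbox 0 1 \<Longrightarrow> z \<in> cbox 0 1 \<Longrightarrow> f (y, z) \<le> B"
  shows "(\<integral>\<^sup>+w. f w \<partial>cube_pair_measure) \<le> B"
proof -
  have "f \<in> borel_measurable (unit_cube_measure \<Otimes>\<^sub>M unit_cube_measure)"
    using assms(1) by (simp only: measurable_cong_sets[OF sets_cube_pair_measure refl])
  from unit_cube.nn_integral_fst[OF this, symmetric] show ?thesis
    by (auto intro!: nn_integral_unit_cube_le assms)
qed

section \<open>Anisotropic dilations and averages over dilated boxes\<close>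

definition dilate :: "('n::finite \<Rightarrow> real) \<Rightarrow> real^'n \<Rightarrow> real^'n" where
  "dilate d z = (\<chi> i. d i * z $ i)"

lemma dilate_nth [simp]: "dilate d z $ i = d i * z $ i"
  by (simp add: dilate_def)

lemma dilate_measurable [measurable]: "dilate d \<in> borel_measurable borel"
  unfolding dilate_def by (intro borel_measurable_continuous_onI continuous_intros)

lemma nn_integral_dilate:
  fixes g :: "real^'n::finite \<Rightarrow> ennreal"
  assumes [measurable]: "g \<in> borel_measurable borel" and d: "\<And>i. 0 < d i"
  shows "(\<integral>\<^sup>+x. g x \<partial>lborel) = ennreal (\<Prod>i\<in>UNIV. d i) * (\<integral>\<^sup>+z. g (x + dilate d z) \<partial>lborel)"
proof -
  define c :: "real^'n \<Rightarrow> real" where "c j = d (THE i. j = axis i 1)" for j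
  have c: "c (axis i 1) = d i" for i
    by (simp add: c_def axis_eq_axis)
  have inj: "inj (\<lambda>i::'n. axis i (1::real))"
    by (auto simp: inj_def axis_eq_axis)
  have Basis: "(Basis :: (real^'n) set) = range (\<lambda>i. axis i 1)"
    by (auto simp: Basis_vec_def)
  have T: "x + (\<Sum>j\<in>Basis. (c j * (z \<bullet> j)) *\<^sub>R j) = x + dilate d z" for z
  proof -
    have "(\<Sum>j\<in>Basis. (c j * (z \<bullet> j)) *\<^sub>R j) = (\<Sum>i\<in>UNIV. (d i * z $ i) *\<^sub>R axis i 1)"
      unfolding Basis by (subst sum.reindex[OF inj]) (simp add: c cart_eq_inner_axis)
    also have "\<dots> = dilate d z"
      by (simp add: vec_eq_iff axis_def if_distrib[of "\<lambda>x. _ * x"] cong: if_cong)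
    finally show ?thesis by simp
  qed
  have P: "(\<Prod>j\<in>Basis. \<bar>c j\<bar>) = (\<Prod>i\<in>UNIV. d i)"
    unfolding Basis by (subst prod.reindex[OF inj]) (simp add: c d less_imp_le)
  have "(\<integral>\<^sup>+x. g x \<partial>lborel) = (\<integral>\<^sup>+y. g y \<partial>density (distr lborel borel (\<lambda>z. x + dilate d z)) (\<lambda>_. ennreal (\<Prod>i\<in>UNIV. d i)))"
  proof -
    have "c j \<noteq> 0" if "j \<in> Basis" for j
      using that d by (auto simp: Basis c less_imp_neq[symmetric])
    then have "lborel = density (distr lborel borel (\<lambda>z. x + dilate d z)) (\<lambda>_. ennreal (\<Prod>i\<in>UNIV. d i))"
      using lborel_affine_euclidean[of c x] unfolding T P by blast
    then show ?thesis by (rule arg_cong)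
  qed
  also have "\<dots> = ennreal (\<Prod>i\<in>UNIV. d i) * (\<integral>\<^sup>+z. g (x + dilate d z) \<partial>lborel)"
    by (simp add: nn_integral_density nn_integral_distr nn_integral_cmult)
  finally show ?thesis .
qed

text \<open>The two endpoint estimates for averaging. Pointwise, the box integral is at most the
  integral over the whole space, up to the box volume; integrated over \<open>x\<close>, translation
  invariance preserves the bound. The parameter \<open>y\<close> leaves room for a second
  box.\<close>

lemma box_average_nn_integral:
  fixes g :: "real^'n::finite \<Rightarrow> real^'n \<Rightarrow> ennreal"
  assumes g[measurable]: "(\<lambda>(y, x). g y x) \<in> borel_measurable borel" and d: "\<And>i. 0 < d i"
    and B: "\<And>y. y \<in> cbox 0 1 \<Longrightarrow> (\<integral>\<^sup>+x. g y x \<partial>lborel) \<le> B"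
  defines "H \<equiv> \<lambda>x. \<integral>\<^sup>+w. g (fst w) (x + dilate d (snd w)) \<partial>cube_pair_measure"
  shows "ennreal (\<Prod>i\<in>UNIV. d i) * H x \<le> B" and "(\<integral>\<^sup>+x. H x \<partial>lborel) \<le> B"
proof -
  have [measurable]: "(\<lambda>(y, x). g y x) \<in> borel_measurable (borel \<Otimes>\<^sub>M borel)"
    by (simp add: borel_prod)
  have [measurable]: "g y \<in> borel_measurable borel" for y
    using measurable_Pair2[of "\<lambda>(y, x). g y x" borel borel borel y] by simp
  have "H x = (\<integral>\<^sup>+y. \<integral>\<^sup>+z. g y (x + dilate d z) \<partial>unit_cube_measure \<partial>unit_cube_measure)"
    unfolding H_def by (subst unit_cube.nn_integral_fst[symmetric]) auto
  then have "ennreal (\<Prod>i\<in>UNIV. d i) * H x =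
    (\<integral>\<^sup>+y. ennreal (\<Prod>i\<in>UNIV. d i) * (\<integral>\<^sup>+z. g y (x + dilate d z) \<partial>unit_cube_measure) \<partial>unit_cube_measure)"
    by (simp add: nn_integral_cmult)
  also have "\<dots> \<le> B"
  proof (rule nn_integral_unit_cube_le)
    fix y :: "real^'n" assume y: "y \<in> cbox 0 1"
    have "(\<integral>\<^sup>+z. g y (x + dilate d z) \<partial>unit_cube_measure) \<le> (\<integral>\<^sup>+z. g y (x + dilate d z) \<partial>lborel)"
      unfolding unit_cube_measure_def
      by (subst nn_integral_density) (auto intro!: nn_integral_mono simp: indicator_def)
    then have "ennreal (\<Prod>i\<in>UNIV. d i) * (\<integral>\<^sup>+z. g y (x + dilate d z) \<partial>unit_cube_measure) \<le> (\<integral>\<^sup>+x. g y x \<partial>lborel)"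
      using nn_integral_dilate[of "g y" d x] d by (simp add: mult_left_mono)
    also have "\<dots> \<le> B" by (rule B[OF y])
    finally show "ennreal (\<Prod>i\<in>UNIV. d i) * (\<integral>\<^sup>+z. g y (x + dilate d z) \<partial>unit_cube_measure) \<le> B" .
  qed
  finally show "ennreal (\<Prod>i\<in>UNIV. d i) * H x \<le> B" .
  have "(\<integral>\<^sup>+x. H x \<partial>lborel) = (\<integral>\<^sup>+w. \<integral>\<^sup>+x. g (fst w) (x + dilate d (snd w)) \<partial>lborel \<partial>cube_pair_measure)"
    unfolding H_def by (rule lborel_cube_pair.Fubini'[symmetric]) measurable
  also have "\<dots> = (\<integral>\<^sup>+w. \<integral>\<^sup>+x. g (fst w) x \<partial>lborel \<partial>cube_pair_measure)"
    by (simp add: nn_integral_translate)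
  also have "\<dots> \<le> B"
    by (intro nn_integral_cube_pair_le) (auto intro: B simp: borel_prod[symmetric])
  finally show "(\<integral>\<^sup>+x. H x \<partial>lborel) \<le> B" .
qed

text \<open>The last estimate interpolates between the uniform bound on \<open>F\<close> and the \<open>p\<close>-th power
  bound that comes from Jensen's inequality and translation invariance.\<close>

lemma box_average_Young:
  fixes f :: "real^'n::finite \<Rightarrow> real^'n \<Rightarrow> real"
  assumes f[measurable]: "(\<lambda>(y, x). f y x) \<in> borel_measurable borel" and d: "\<And>i. 0 < d i"
    and p: "1 \<le> p" and \<beta>: "0 \<le> \<beta>"
    and f_le: "\<And>y. y \<in> cbox 0 1 \<Longrightarrow> pow_int p (f y) \<le> ennreal (\<beta> powr p)"
  defines "V \<equiv> \<Prod>i\<in>UNIV. d i"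
    and "F \<equiv> \<lambda>x. \<integral>w. f (fst w) (x + dilate d (snd w)) \<partial>cube_pair_measure"
  shows "integrable cube_pair_measure (\<lambda>w. f (fst w) (x + dilate d (snd w)))"
    and "F \<in> borel_measurable borel"
    and "\<bar>F x\<bar> \<le> V powr (- 1 / p) * \<beta>"
    and "p \<le> q \<Longrightarrow> pow_int q F \<le> ennreal ((V powr (- (1 / p - 1 / q)) * \<beta>) powr q)"
proof -
  have [measurable]: "(\<lambda>(y, x). f y x) \<in> borel_measurable (borel \<Otimes>\<^sub>M borel)"
    by (simp add: borel_prod)
  have V: "0 < V" unfolding V_def by (intro prod_pos) (auto simp: d)
  define H where "H x = (\<integral>\<^sup>+w. ennreal (\<bar>f (fst w) (x + dilate d (snd w))\<bar> powr p) \<partial>cube_pair_measure)" for x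
  have g: "(\<lambda>(y, x). ennreal (\<bar>f y x\<bar> powr p)) \<in> borel_measurable borel"
    unfolding borel_prod[symmetric] by measurable
  have HV: "ennreal V * H x \<le> ennreal (\<beta> powr p)" and H_int: "(\<integral>\<^sup>+x. H x \<partial>lborel) \<le> ennreal (\<beta> powr p)" for x
    unfolding H_def V_def using f_le
    by (intro box_average_nn_integral[OF g d]; simp add: pow_int_def)+
  have H_le: "H x \<le> ennreal (\<beta> powr p / V)" for x
  proof -
    have "H x = ennreal (1 / V) * (ennreal V * H x)"
      using V by (simp add: mult.assoc[symmetric] ennreal_mult[symmetric])
    also have "\<dots> \<le> ennreal (1 / V) * ennreal (\<beta> powr p)"
      by (intro mult_left_mono HV) simp
    also have "\<dots> = ennreal (\<beta> powr p / V)"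
      using V by (simp flip: ennreal_mult)
    finally show ?thesis .
  qed
  show int: "integrable cube_pair_measure (\<lambda>w. f (fst w) (x + dilate d (snd w)))" for x
  proof (rule integrableI_bounded)
    show "(\<lambda>w. f (fst w) (x + dilate d (snd w))) \<in> borel_measurable cube_pair_measure"
      by measurable
    have "(\<integral>\<^sup>+w. ennreal (norm (f (fst w) (x + dilate d (snd w)))) \<partial>cube_pair_measure)
      \<le> (\<integral>\<^sup>+w. ennreal 1 + ennreal (\<bar>f (fst w) (x + dilate d (snd w))\<bar> powr p) \<partial>cube_pair_measure)"
    proof (rule nn_integral_mono)
      fix w
      show "ennreal (norm (f (fst w) (x + dilate d (snd w)))) \<le> ennreal 1 + ennreal (\<bar>f (fst w) (x + dilate d (snd w))\<bar> powr p)"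
        using abs_le_add_powr[OF p, of 1 "f (fst w) (x + dilate d (snd w))"]
        by (simp flip: ennreal_plus ennreal_1)
    qed
    also have "\<dots> = 1 + H x"
      by (simp add: nn_integral_add H_def)
    also have "\<dots> < \<infinity>"
      using order_le_less_trans[OF H_le[of x] ennreal_less_top] by (simp add: ennreal_add_less_top)
    finally show "(\<integral>\<^sup>+w. ennreal (norm (f (fst w) (x + dilate d (snd w)))) \<partial>cube_pair_measure) < \<infinity>" .
  qed
  show F[measurable]: "F \<in> borel_measurable borel"
    unfolding F_def by measurable
  have FH: "ennreal (\<bar>F x\<bar> powr p) \<le> H x" for x
    unfolding F_def H_def by (rule Jensen_powr[OF emeasure_cube_pair_measure int p])
  show F_le: "\<bar>F x\<bar> \<le> V powr (- 1 / p) * \<beta>" for x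
  proof -
    have "\<bar>F x\<bar> powr p \<le> \<beta> powr p / V"
      using order_trans[OF FH H_le] V by (subst (asm) ennreal_le_iff) auto
    then have "(\<bar>F x\<bar> powr p) powr (1 / p) \<le> (\<beta> powr p / V) powr (1 / p)"
      using p by (intro powr_mono2) auto
    then show ?thesis
      using p V \<beta> by (simp add: powr_powr powr_divide powr_minus field_simps)
  qed
  show "pow_int q F \<le> ennreal ((V powr (- (1 / p - 1 / q)) * \<beta>) powr q)" if q: "p \<le> q"
  proof -
    \<comment> \<open>A bound for the supremum of \<open>\<bar>F\<bar>\<close>, raised to
      \<open>q - p\<close>, so that the q-th power is at most \<open>c\<close> times the p-th
      power.\<close>
    define c where "c = (V powr (- 1 / p) * \<beta>) powr (q - p)"
    have "pow_int q F \<le> (\<integral>\<^sup>+x. ennreal c * H x \<partial>lborel)"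
      unfolding pow_int_def
    proof (rule nn_integral_mono)
      fix x
      have "\<bar>F x\<bar> powr q = \<bar>F x\<bar> powr (q - p) * \<bar>F x\<bar> powr p"
        by (simp flip: powr_add)
      also have "\<dots> \<le> c * \<bar>F x\<bar> powr p"
        unfolding c_def using q F_le by (intro mult_right_mono powr_mono2) auto
      finally have "ennreal (\<bar>F x\<bar> powr q) \<le> ennreal c * ennreal (\<bar>F x\<bar> powr p)"
        by (simp add: c_def flip: ennreal_mult)
      also have "\<dots> \<le> ennreal c * H x"
        by (intro mult_left_mono FH) simp
      finally show "ennreal (\<bar>F x\<bar> powr q) \<le> ennreal c * H x" .
    qed
    also have "\<dots> = ennreal c * (\<integral>\<^sup>+x. H x \<partial>lborel)"
      unfolding H_def by (intro nn_integral_cmult) measurable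
    also have "\<dots> \<le> ennreal c * ennreal (\<beta> powr p)"
      by (intro mult_left_mono H_int) simp
    also have "\<dots> = ennreal (c * \<beta> powr p)"
      by (simp add: c_def flip: ennreal_mult)
    also have "c * \<beta> powr p = (V powr (- (1 / p - 1 / q)) * \<beta>) powr q"
    proof (cases "\<beta> = 0")
      case False
      have "c * \<beta> powr p = V powr (- (1 / p) * (q - p)) * (\<beta> powr (q - p) * \<beta> powr p)"
        using V by (simp add: c_def powr_mult powr_powr)
      also have "\<beta> powr (q - p) * \<beta> powr p = \<beta> powr q"
        by (simp flip: powr_add)
      also have "- (1 / p) * (q - p) = - (1 / p - 1 / q) * q"
        using p q by (simp add: field_simps)
      finally show ?thesis
        using V by (simp add: powr_mult powr_powr)
    qed (use q p in auto)
    finally show ?thesis .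
  qed
qed

subsection \<open>Approximation by box averages\<close>

lemma AE_summable_of_nn_integral:
  fixes f :: "nat \<Rightarrow> 'a \<Rightarrow> real"
  assumes [measurable]: "\<And>k. f k \<in> borel_measurable M" and nonneg: "\<And>k x. 0 \<le> f k x"
    and le: "\<And>k. (\<integral>\<^sup>+x. ennreal (f k x) \<partial>M) \<le> ennreal (b k)" and b: "\<And>k. 0 \<le> b k" "summable b"
  shows "AE x in M. summable (\<lambda>k. f k x)"
proof -
  have "(\<integral>\<^sup>+x. (\<Sum>k. ennreal (f k x)) \<partial>M) = (\<Sum>k. \<integral>\<^sup>+x. ennreal (f k x) \<partial>M)"
    by (rule nn_integral_suminf) measurable
  also have "\<dots> \<le> (\<Sum>k. ennreal (b k))"
    by (intro suminf_le le) auto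
  also have "\<dots> = ennreal (\<Sum>k. b k)"
    using b by (intro suminf_ennreal2) auto
  finally have "(\<integral>\<^sup>+x. (\<Sum>k. ennreal (f k x)) \<partial>M) \<noteq> \<infinity>"
    by (auto simp: top_unique)
  then have "AE x in M. (\<Sum>k. ennreal (f k x)) \<noteq> \<infinity>"
    by (intro nn_integral_PInf_AE) auto
  then show ?thesis
    by eventually_elim (auto intro!: summable_suminf_not_top nonneg)
qed

lemma pow_int_Fatou:
  fixes f :: "nat \<Rightarrow> 'a::euclidean_space \<Rightarrow> real"
  assumes [measurable]: "\<And>k. f k \<in> borel_measurable borel" and p: "0 < p"
    and lim: "AE x in lborel. (\<lambda>k. f k x) \<longlonglongrightarrow> g x"
    and le: "\<forall>\<^sub>F k in sequentially. pow_int p (f k) \<le> B"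
  shows "pow_int p g \<le> B"
proof -
  have "pow_int p g \<le> (\<integral>\<^sup>+x. liminf (\<lambda>k. ennreal (\<bar>f k x\<bar> powr p)) \<partial>lborel)"
    unfolding pow_int_def
  proof (rule nn_integral_mono_AE)
    show "AE x in lborel. ennreal (\<bar>g x\<bar> powr p) \<le> liminf (\<lambda>k. ennreal (\<bar>f k x\<bar> powr p))"
      using lim
    proof eventually_elim
      case (elim x)
      have "(\<lambda>k. ennreal (\<bar>f k x\<bar> powr p)) \<longlonglongrightarrow> ennreal (\<bar>g x\<bar> powr p)"
        using p by (intro tendsto_ennrealI tendsto_powr' tendsto_intros elim) auto
      from lim_imp_Liminf[OF _ this] show ?case
        by (simp del: tendsto_ennreal_iff)
    qed
  qed
  also have "\<dots> \<le> liminf (\<lambda>k. pow_int p (f k))"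
    unfolding pow_int_def by (intro nn_integral_liminf) measurable
  also have "\<dots> \<le> B"
    using le by (intro Liminf_le) auto
  finally show ?thesis .
qed

text \<open>The tail bound is Minkowski's inequality for finite sums followed by Fatou's lemma. The
  limit \<open>g\<close> is an argument because it is in one use a given function and in the other a
  constructed one.\<close>

lemma pow_int_telescope:
  fixes f :: "nat \<Rightarrow> 'a::euclidean_space \<Rightarrow> real"
  assumes f[measurable]: "\<And>k. f k \<in> borel_measurable borel"
    and p: "1 \<le> p" and K: "0 \<le> K" and \<rho>: "0 < \<rho>" "\<rho> < 1"
    and step: "\<And>k. pow_int p (\<lambda>x. f (Suc k) x - f k x) \<le> ennreal ((K * \<rho> ^ k) powr p)"
  shows pow_int_telescope_convergent: "AE x in lborel. convergent (\<lambda>k. f k x)"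
    and pow_int_telescope_limit: "\<And>g. g \<in> borel_measurable borel \<Longrightarrow> AE x in lborel. (\<lambda>k. f k x) \<longlonglongrightarrow> g x \<Longrightarrow>
      pow_int p (\<lambda>x. g x - f m x) \<le> ennreal ((K / (1 - \<rho>) * \<rho> ^ m) powr p)"
proof -
  have summable_\<rho>: "summable (\<lambda>k. \<rho> ^ k)" using \<rho> by simp
  \<comment> \<open>The weight turns the bound \<open>(K * \<rho> ^ k) powr p\<close> into the
    summable \<open>K powr p * \<rho> ^ k\<close>. It is also the weight in
    \<open>abs_le_add_powr\<close> at \<open>\<rho> ^ k\<close>, which then makes the steps
    themselves summable.\<close>
  have "AE x in lborel. summable (\<lambda>k. (\<rho> ^ k) powr (1 - p) * \<bar>f (Suc k) x - f k x\<bar> powr p)"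
  proof (rule AE_summable_of_nn_integral)
    fix k
    have "(\<integral>\<^sup>+x. ennreal ((\<rho> ^ k) powr (1 - p) * \<bar>f (Suc k) x - f k x\<bar> powr p) \<partial>lborel)
      = ennreal ((\<rho> ^ k) powr (1 - p)) * pow_int p (\<lambda>x. f (Suc k) x - f k x)"
      by (simp add: ennreal_mult nn_integral_cmult pow_int_def)
    also have "\<dots> \<le> ennreal ((\<rho> ^ k) powr (1 - p)) * ennreal ((K * \<rho> ^ k) powr p)"
      by (intro mult_left_mono step) simp
    also have "\<dots> = ennreal ((\<rho> ^ k) powr (1 - p) * (K * \<rho> ^ k) powr p)"
      by (simp flip: ennreal_mult)
    also have "(\<rho> ^ k) powr (1 - p) * (K * \<rho> ^ k) powr p = K powr p * ((\<rho> ^ k) powr (1 - p) * (\<rho> ^ k) powr p)"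
      by (simp add: powr_mult)
    also have "\<dots> = K powr p * \<rho> ^ k"
      using \<rho> by (simp flip: powr_add)
    finally show "(\<integral>\<^sup>+x. ennreal ((\<rho> ^ k) powr (1 - p) * \<bar>f (Suc k) x - f k x\<bar> powr p) \<partial>lborel) \<le> ennreal (K powr p * \<rho> ^ k)" .
  qed (use \<rho> summable_\<rho> in auto)
  then show "AE x in lborel. convergent (\<lambda>k. f k x)"
  proof eventually_elim
    case (elim x)
    have "summable (\<lambda>k. f (Suc k) x - f k x)"
    proof (rule summable_comparison_test')
      show "summable (\<lambda>k. \<rho> ^ k + (\<rho> ^ k) powr (1 - p) * \<bar>f (Suc k) x - f k x\<bar> powr p)"
        by (intro summable_add summable_\<rho> elim)
      show "norm (f (Suc k) x - f k x) \<le> \<rho> ^ k + (\<rho> ^ k) powr (1 - p) * \<bar>f (Suc k) x - f k x\<bar> powr p" if "0 \<le> k" for k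
        using abs_le_add_powr[OF p, of "\<rho> ^ k" "f (Suc k) x - f k x"] \<rho> by simp
    qed
    then have "convergent (\<lambda>n. f n x - f 0 x)"
      by (simp only: summable_iff_convergent sum_lessThan_telescope[of "\<lambda>n. f n x"])
    from convergent_add[OF this convergent_const[of "f 0 x"]] show ?case by simp
  qed
  have fin: "pow_int p (\<lambda>x. f N x - f m x) \<le> ennreal ((K / (1 - \<rho>) * \<rho> ^ m) powr p)" if "m \<le> N" for N
  proof -
    have "pow_int p (\<lambda>x. f N x - f m x) = pow_int p (\<lambda>x. \<Sum>j\<in>{m..<N}. f (Suc j) x - f j x)"
      using sum_Suc_diff'[OF that, of "\<lambda>j. f j x" for x] by simp
    also have "\<dots> \<le> ennreal ((\<Sum>j\<in>{m..<N}. K * \<rho> ^ j) powr p)"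
      using K \<rho> by (intro Minkowski_pow_int_sum p step) auto
    also have "(\<Sum>j\<in>{m..<N}. K * \<rho> ^ j) \<le> K / (1 - \<rho>) * \<rho> ^ m"
    proof -
      have "(\<Sum>j\<in>{m..<N}. \<rho> ^ j) = (\<rho> ^ m - \<rho> ^ N) / (1 - \<rho>)"
        using that
      proof (induction N rule: dec_induct)
        case (step N)
        have "(\<rho> ^ m - \<rho> ^ N) / (1 - \<rho>) + \<rho> ^ N = (\<rho> ^ m - \<rho> ^ Suc N) / (1 - \<rho>)"
          using \<rho> by (simp add: field_simps)
        with step show ?case by simp
      qed simp
      also have "\<dots> \<le> \<rho> ^ m / (1 - \<rho>)"
        using \<rho> by (intro divide_right_mono) auto
      finally show ?thesis
        using K mult_left_mono[of "\<Sum>j\<in>{m..<N}. \<rho> ^ j" "\<rho> ^ m / (1 - \<rho>)" K]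
        by (simp flip: sum_distrib_left)
    qed
    then have "ennreal ((\<Sum>j\<in>{m..<N}. K * \<rho> ^ j) powr p) \<le> ennreal ((K / (1 - \<rho>) * \<rho> ^ m) powr p)"
      using K \<rho> p by (intro ennreal_leI powr_mono2) (auto intro!: sum_nonneg)
    finally show ?thesis .
  qed
  fix g assume g[measurable]: "g \<in> borel_measurable borel" and lim: "AE x in lborel. (\<lambda>k. f k x) \<longlonglongrightarrow> g x"
  show "pow_int p (\<lambda>x. g x - f m x) \<le> ennreal ((K / (1 - \<rho>) * \<rho> ^ m) powr p)"
  proof (rule pow_int_Fatou)
    show "AE x in lborel. (\<lambda>N. f N x - f m x) \<longlonglongrightarrow> g x - f m x"
      using lim by eventually_elim (intro tendsto_intros)
    show "\<forall>\<^sub>F N in sequentially. pow_int p (\<lambda>x. f N x - f m x) \<le> ennreal ((K / (1 - \<rho>) * \<rho> ^ m) powr p)"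
      using fin by (auto simp: eventually_sequentially)
  qed (use p in auto)
qed

text \<open>Averaging over two independent boxes instead of one: when the box belonging to one variable
  is changed, the other variable still smooths the resulting differences, so that
  the Young-type estimate above applies to them.\<close>

definition box_mean :: "(real^'n::finite \<Rightarrow> real) \<Rightarrow> ('n \<Rightarrow> real) \<Rightarrow> ('n \<Rightarrow> real) \<Rightarrow> real^'n \<Rightarrow> real" where
  "box_mean u d e x = (\<integral>w. u (x + dilate d (snd w) + dilate e (fst w)) \<partial>cube_pair_measure)"

text \<open>The two box variables are independent and identically distributed. The symmetry lets
  either box do the smoothing while the other one is changed.\<close>

lemma box_mean_commute:
  assumes [measurable]: "u \<in> borel_measurable borel"
  shows "box_mean u d e = box_mean u e d"
proof
  fix x
  have "(\<integral>(z, y). u (x + dilate d y + dilate e z) \<partial>cube_pair_measure)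
    = integral\<^sup>L cube_pair_measure (\<lambda>(y, z). u (x + dilate d y + dilate e z))"
    using unit_cube_pair.integral_product_swap[of "\<lambda>(y, z). u (x + dilate d y + dilate e z)"]
    by simp
  then show "box_mean u d e x = box_mean u e d x"
    by (simp add: box_mean_def case_prod_beta' ac_simps)
qed

text \<open>A Nikol'skii-type bound whose order and exponent depend on the direction. All parameters
  except \<open>u\<close> will be shared by the whole sequence, which makes the conclusions uniform.
  Steps up to 2 are needed because two box displacements of size at most 1 are added.\<close>

locale nikolskii_bound =
  fixes u :: "real^'n::finite \<Rightarrow> real" and p \<sigma> a :: "'n \<Rightarrow> real" and q C \<epsilon> :: real
  assumes u[measurable]: "u \<in> borel_measurable borel"
    and p: "1 \<le> p i" "p i \<le> q" and \<sigma>: "0 < \<sigma> i" and C: "0 \<le> C" and a: "0 < a i" "(\<Sum>i\<in>UNIV. a i) = 1"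
    and \<epsilon>: "0 < \<epsilon>" "\<epsilon> \<le> a i * \<sigma> i - (1 / p i - 1 / q)"
    and u_le: "pow_int q u \<le> ennreal (C powr q)"
    and diff_le: "\<bar>t\<bar> \<le> 2 \<Longrightarrow>
      pow_int (p i) (\<lambda>x. u (x + t *\<^sub>R axis i 1) - u x) \<le> ennreal ((C * \<bar>t\<bar> powr \<sigma> i) powr p i)"
begin

definition side :: "nat \<Rightarrow> 'n \<Rightarrow> real" where
  "side m i = 2 powr (- (real m * a i))"

definition mean :: "nat \<Rightarrow> real^'n \<Rightarrow> real" where
  "mean m = box_mean u (side m) (side m)"

lemma q: "1 \<le> q"
  using p[of undefined] by linarith

lemma side: "0 < side m i" "side m i \<le> 1" "side (Suc m) i \<le> side m i"
  using a(1)[of i] powr_mono[of "- (real m * a i)" 0 2] by (auto simp: side_def algebra_simps)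

lemma prod_side: "(\<Prod>i\<in>UNIV. side m i) = 2 powr (- real m)"
proof -
  have "(\<Prod>i\<in>UNIV. side m i) = 2 powr (\<Sum>i\<in>UNIV. - (real m * a i))"
    by (simp add: side_def powr_sum)
  then show ?thesis by (simp add: sum_negf a(2) flip: sum_distrib_left)
qed

lemma pow_int_translate_diff:
  assumes "\<bar>t\<bar> \<le> r" "r \<le> 2"
  shows "pow_int (p i) (\<lambda>x. u (x + (c + t *\<^sub>R axis i 1)) - u (x + c)) \<le> ennreal ((C * r powr \<sigma> i) powr p i)"
proof -
  have "pow_int (p i) (\<lambda>x. u (x + (c + t *\<^sub>R axis i 1)) - u (x + c)) = pow_int (p i) (\<lambda>x. u (x + t *\<^sub>R axis i 1) - u x)"
    using pow_int_translate[of "\<lambda>x. u (x + t *\<^sub>R axis i 1) - u x" "p i" c] by (simp add: add.assoc)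
  also have "\<dots> \<le> ennreal ((C * \<bar>t\<bar> powr \<sigma> i) powr p i)"
    using assms by (intro diff_le) auto
  also have "\<dots> \<le> ennreal ((C * r powr \<sigma> i) powr p i)"
    using assms p[of i] \<sigma>[of i] C by (intro ennreal_leI powr_mono2 mult_left_mono) auto
  finally show ?thesis .
qed

lemma translate_measurable [measurable]:
  "(\<lambda>(y, x). u (x + dilate e y)) \<in> borel_measurable borel"
  unfolding borel_prod[symmetric] by measurable

lemma
  assumes d: "\<And>i. 0 < d i"
  shows box_mean_integrable: "integrable cube_pair_measure (\<lambda>w. u (x + dilate d (snd w) + dilate e (fst w)))"
    and box_mean_measurable: "box_mean u d e \<in> borel_measurable borel"
    and box_mean_bounded: "\<bar>box_mean u d e x\<bar> \<le> (\<Prod>i\<in>UNIV. d i) powr (- 1 / q) * C"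
proof -
  have "pow_int q (\<lambda>x. u (x + dilate e y)) \<le> ennreal (C powr q)" for y
    using u_le by (simp add: pow_int_translate)
  note Y = box_average_Young[OF translate_measurable d q C this]
  show "integrable cube_pair_measure (\<lambda>w. u (x + dilate d (snd w) + dilate e (fst w)))"
    by (rule Y(1))
  show "box_mean u d e \<in> borel_measurable borel"
    using Y(2) by (simp add: box_mean_def[abs_def])
  show "\<bar>box_mean u d e x\<bar> \<le> (\<Prod>i\<in>UNIV. d i) powr (- 1 / q) * C"
    using Y(3)[of x] by (simp add: box_mean_def)
qed

text \<open>Changing one side of the box \<open>e\<close> moves the argument of \<open>u\<close>
  along a single axis, where the difference bound has exponent \<open>p i\<close>; averaging over
  the untouched box \<open>d\<close> lifts it to \<open>q\<close>.\<close>

lemma box_mean_change_coordinate: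
  assumes d: "\<And>i. 0 < d i" and e: "\<And>j. j \<noteq> i \<Longrightarrow> e j = e' j" and r: "\<bar>e i - e' i\<bar> \<le> r" "r \<le> 2"
  shows "pow_int q (\<lambda>x. box_mean u d e x - box_mean u d e' x)
    \<le> ennreal (((\<Prod>i\<in>UNIV. d i) powr (- (1 / p i - 1 / q)) * (C * r powr \<sigma> i)) powr q)"
proof -
  define f where "f y x = u (x + dilate e y) - u (x + dilate e' y)" for y x :: "real^'n"
  have f: "(\<lambda>(y, x). f y x) \<in> borel_measurable borel"
    unfolding f_def borel_prod[symmetric] by measurable
  have "pow_int (p i) (f y) \<le> ennreal ((C * r powr \<sigma> i) powr p i)" if y: "y \<in> cbox 0 1" for y
  proof -
    have eq: "dilate e y = dilate e' y + ((e i - e' i) * y $ i) *\<^sub>R axis i 1"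
      using e by (auto simp: vec_eq_iff axis_def algebra_simps)
    have "\<bar>(e i - e' i) * y $ i\<bar> \<le> \<bar>e i - e' i\<bar> * 1"
      unfolding abs_mult using y by (intro mult_left_mono) (auto simp: mem_box_cart)
    then show ?thesis
      unfolding f_def eq using r by (intro pow_int_translate_diff) auto
  qed
  from box_average_Young(4)[OF f d p(1)[of i] _ this p(2)[of i]]
  have "pow_int q (\<lambda>x. \<integral>w. f (fst w) (x + dilate d (snd w)) \<partial>cube_pair_measure)
    \<le> ennreal (((\<Prod>i\<in>UNIV. d i) powr (- (1 / p i - 1 / q)) * (C * r powr \<sigma> i)) powr q)"
    using C by simp
  then show ?thesis
    by (simp add: f_def box_mean_def box_mean_integrable d)
qed

lemma box_mean_change:
  assumes d: "\<And>i. 0 < d i" and r: "\<And>i. \<bar>e i - e' i\<bar> \<le> r i" "\<And>i. r i \<le> 2"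
  shows "pow_int q (\<lambda>x. box_mean u d e x - box_mean u d e' x)
    \<le> ennreal ((\<Sum>i\<in>UNIV. (\<Prod>i\<in>UNIV. d i) powr (- (1 / p i - 1 / q)) * (C * r i powr \<sigma> i)) powr q)"
proof -
  define b where "b i = (\<Prod>i\<in>UNIV. d i) powr (- (1 / p i - 1 / q)) * (C * r i powr \<sigma> i)" for i
  have b: "0 \<le> b i" for i using C by (simp add: b_def)
  have bm[measurable]: "box_mean u d e \<in> borel_measurable borel" for e
    by (rule box_mean_measurable[OF d])
  \<comment> \<open>Passes from \<open>e\<close> to \<open>e'\<close> one coordinate at a time; the
    errors now share the exponent \<open>q\<close>, so Minkowski's inequality adds them.\<close>
  define mix where "mix I j = (if j \<in> I then e' j else e j)" for I j
  have "pow_int q (\<lambda>x. box_mean u d e x - box_mean u d (mix I) x) \<le> ennreal ((\<Sum>i\<in>I. b i) powr q)" for I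
    using finite[of I]
  proof (induction I)
    case empty
    have "mix {} = e" by (simp add: mix_def fun_eq_iff)
    then show ?case by (simp add: pow_int_def)
  next
    case (insert i I)
    have "pow_int q (\<lambda>x. box_mean u d (mix I) x - box_mean u d (mix (insert i I)) x) \<le> ennreal (b i powr q)"
      unfolding b_def using r insert.hyps
      by (intro box_mean_change_coordinate d) (auto simp: mix_def)
    from Minkowski_pow_int[OF _ _ q _ _ insert.IH this]
    show ?case
      using insert.hyps b by (simp add: sum_nonneg add.commute)
  qed
  from this[of UNIV] have "pow_int q (\<lambda>x. box_mean u d e x - box_mean u d (mix UNIV) x) \<le> ennreal ((\<Sum>i\<in>UNIV. b i) powr q)" .
  moreover have "mix UNIV = e'" by (simp add: mix_def fun_eq_iff)
  ultimately show ?thesis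
    by (simp only: b_def)
qed

section \<open>Averages at scale \<open>m\<close>: supremum, steps and translations\<close>

lemma mean_measurable [measurable]: "mean m \<in> borel_measurable borel"
  unfolding mean_def by (intro box_mean_measurable side)

lemma mean_bounded: "\<bar>mean m x\<bar> \<le> 2 powr (real m / q) * C"
  using box_mean_bounded[where d="side m" and e="side m" and x=x, OF side(1)]
  by (simp add: mean_def prod_side powr_powr)

lemma mean_step:
  "pow_int q (\<lambda>x. mean (Suc m) x - mean m x)
    \<le> ennreal ((4 * real CARD('n) * C * (2 powr (- \<epsilon>)) ^ m) powr q)"
proof -
  define b where "b = real CARD('n) * (2 * C * (2 powr (- \<epsilon>)) ^ m)"
  have b: "0 \<le> b" using C by (simp add: b_def)
  \<comment> \<open>Smoothing at scale m + 1 instead of m costs at most a factor 2, since 1 / p i -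
    1 / q is at most 1. With one term per coordinate and two such halves, the constant becomes
    \<open>4 * real CARD('n) * C\<close>.\<close>
  have half: "pow_int q (\<lambda>x. box_mean u (side k) (side (Suc m)) x - box_mean u (side k) (side m) x) \<le> ennreal (b powr q)"
    if k: "k = m \<or> k = Suc m" for k
  proof -
    have "(\<Prod>i\<in>UNIV. side k i) powr (- (1 / p i - 1 / q)) * (C * side m i powr \<sigma> i) \<le> 2 * C * (2 powr (- \<epsilon>)) ^ m" for i
    proof -
      define \<delta> where "\<delta> = 1 / p i - 1 / q"
      have \<delta>: "0 \<le> \<delta>" "\<delta> \<le> 1"
        using p[of i] q by (auto simp: \<delta>_def frac_le intro: order_trans[of _ "1 / p i"])
      have "real k * \<delta> \<le> real m * \<delta> + 1"
        using \<delta> k by (auto simp: algebra_simps)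
      moreover have "real m * \<epsilon> \<le> real m * (a i * \<sigma> i - \<delta>)"
        using \<epsilon>(2)[of i] by (intro mult_left_mono) (auto simp: \<delta>_def)
      ultimately have "real k * \<delta> - real m * (a i * \<sigma> i) \<le> 1 - real m * \<epsilon>"
        by (simp add: algebra_simps)
      then have "2 powr (real k * \<delta> - real m * (a i * \<sigma> i)) \<le> 2 powr (1 - real m * \<epsilon>)"
        by simp
      also have "2 powr (1 - real m * \<epsilon>) = 2 * (2 powr (- \<epsilon>)) ^ m"
        by (simp add: powr_diff powr_realpow[symmetric] powr_powr powr_minus field_simps)
      finally have "2 powr (real k * \<delta>) * 2 powr (- (real m * a i * \<sigma> i)) \<le> 2 * (2 powr (- \<epsilon>)) ^ m"
        by (simp add: powr_add[symmetric] mult.assoc)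
      then have "C * (2 powr (real k * \<delta>) * 2 powr (- (real m * a i * \<sigma> i))) \<le> C * (2 * (2 powr (- \<epsilon>)) ^ m)"
        using C by (intro mult_left_mono) auto
      then show ?thesis
        unfolding prod_side by (simp add: side_def powr_powr \<delta>_def[symmetric] mult_ac)
    qed
    then have "(\<Sum>i\<in>UNIV. (\<Prod>i\<in>UNIV. side k i) powr (- (1 / p i - 1 / q)) * (C * side m i powr \<sigma> i)) \<le> b"
      unfolding b_def by (intro sum_bounded_above) auto
    then have "ennreal ((\<Sum>i\<in>UNIV. (\<Prod>i\<in>UNIV. side k i) powr (- (1 / p i - 1 / q)) * (C * side m i powr \<sigma> i)) powr q)
      \<le> ennreal (b powr q)"
      using q C by (intro ennreal_leI powr_mono2) (auto intro!: sum_nonneg)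
    moreover have "\<bar>side (Suc m) i - side m i\<bar> \<le> side m i" "side m i \<le> 2" for i
      using side[of m i] side(1)[of "Suc m" i] by auto
    ultimately show ?thesis
      by (intro order_trans[OF box_mean_change[of "side k" "side (Suc m)" "side m" "side m"]] side)
  qed
  \<comment> \<open>Only one box shrinks at a time: by symmetry the mixed average that ends the
    first difference is the one that starts the second.\<close>
  have "mean (Suc m) x - mean m x =
     (box_mean u (side (Suc m)) (side (Suc m)) x - box_mean u (side (Suc m)) (side m) x) +
     (box_mean u (side m) (side (Suc m)) x - box_mean u (side m) (side m) x)" for x
    by (simp add: mean_def box_mean_commute[OF u, of "side m" "side (Suc m)"])
  moreover have "pow_int q (\<lambda>x. (box_mean u (side (Suc m)) (side (Suc m)) x - box_mean u (side (Suc m)) (side m) x) +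
     (box_mean u (side m) (side (Suc m)) x - box_mean u (side m) (side m) x)) \<le> ennreal ((b + b) powr q)"
    using half by (intro Minkowski_pow_int q b) (auto intro!: box_mean_measurable borel_measurable_diff side)
  moreover have "b + b = 4 * real CARD('n) * C * (2 powr (- \<epsilon>)) ^ m"
    by (simp add: b_def)
  ultimately show ?thesis by simp
qed

text \<open>The translation is moved inside the average: one box variable is then a mere parameter,
  the other yields the supremum bound. The factor \<open>2 powr (real m / p i)\<close> is weakened
  to one that is common to all directions.\<close>

lemma mean_translate_coordinate:
  assumes "\<bar>t\<bar> \<le> 2"
  shows "\<bar>mean m (x + t *\<^sub>R axis i 1) - mean m x\<bar> \<le> 2 powr (real m) * C * \<bar>t\<bar> powr \<sigma> i"
proof -
  define f where "f y x = u (x + (dilate (side m) y + t *\<^sub>R axis i 1)) - u (x + dilate (side m) y)" for y x :: "real^'n"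
  have f: "(\<lambda>(y, x). f y x) \<in> borel_measurable borel"
    unfolding f_def borel_prod[symmetric] by measurable
  have "pow_int (p i) (f y) \<le> ennreal ((C * \<bar>t\<bar> powr \<sigma> i) powr p i)" for y
    unfolding f_def using assms by (intro pow_int_translate_diff) auto
  from box_average_Young(3)[where d="side m", OF f side(1) p(1)[of i] _ this, of x]
  have "\<bar>\<integral>w. f (fst w) (x + dilate (side m) (snd w)) \<partial>cube_pair_measure\<bar> \<le> 2 powr (real m / p i) * (C * \<bar>t\<bar> powr \<sigma> i)"
    using C by (simp add: prod_side powr_powr)
  also have "\<dots> \<le> 2 powr (real m) * (C * \<bar>t\<bar> powr \<sigma> i)"
    using C p(1)[of i] by (intro mult_right_mono) (auto simp: divide_le_eq mult_le_cancel_left1)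
  also have "(\<integral>w. f (fst w) (x + dilate (side m) (snd w)) \<partial>cube_pair_measure) = mean m (x + t *\<^sub>R axis i 1) - mean m x"
    using box_mean_integrable[where d="side m" and e="side m" and x="x + t *\<^sub>R axis i 1", OF side(1)]
      box_mean_integrable[where d="side m" and e="side m" and x=x, OF side(1)]
    by (simp add: f_def mean_def box_mean_def ac_simps)
  finally show ?thesis by (simp add: mult.assoc)
qed

text \<open>Convergence of the averages is derived from the difference bounds instead of a
  differentiation theorem for boxes: at steps of size \<open>2 * side k i\<close> the power
  integrals decay geometrically, hence are summable even with the weight
  \<open>r k powr (1 - p i)\<close>. The conclusion uses first powers because contributions with
  different \<open>p i\<close> are to be added; \<open>c k\<close> stands for the displacement
  already made along other axes.\<close>

lemma AE_coordinate_difference_tendsto_0: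
  fixes c :: "nat \<Rightarrow> (real^'n) \<times> (real^'n) \<Rightarrow> real^'n" and t :: "nat \<Rightarrow> (real^'n) \<times> (real^'n) \<Rightarrow> real"
  assumes [measurable]: "\<And>k. c k \<in> borel_measurable borel" "\<And>k. t k \<in> borel_measurable borel"
    and t: "\<And>k y z. y \<in> cbox 0 1 \<Longrightarrow> z \<in> cbox 0 1 \<Longrightarrow> \<bar>t k (y, z)\<bar> \<le> 2 * side k i"
  shows "AE x in lborel. (\<lambda>k. \<integral>\<^sup>+w. ennreal \<bar>u (x + (c k w + t k w *\<^sub>R axis i 1)) - u (x + c k w)\<bar> \<partial>cube_pair_measure) \<longlonglongrightarrow> 0"
proof -
  note [measurable_cong] = sets_cube_pair_measure
  define f where "f k x w = u (x + (c k w + t k w *\<^sub>R axis i 1)) - u (x + c k w)" for k x w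
  define X where "X k x = (\<integral>\<^sup>+w. ennreal (\<bar>f k x w\<bar> powr p i) \<partial>cube_pair_measure)" for k x
  define r where "r k = side k i powr \<sigma> i" for k
  define \<rho> where "\<rho> = 2 powr (- (a i * \<sigma> i))"
  have \<rho>: "0 < \<rho>" "\<rho> < 1"
    using a(1)[of i] \<sigma>[of i] powr_less_mono[of "- (a i * \<sigma> i)" 0 2] by (auto simp: \<rho>_def)
  have r: "r k = \<rho> ^ k" for k
    by (simp add: r_def \<rho>_def side_def powr_powr powr_realpow[symmetric] mult_ac)
  have r0: "0 < r k" for k using \<rho> by (simp add: r)
  define K where "K = (C * 2 powr \<sigma> i) powr p i"
  have [measurable]: "(\<lambda>(x, w). f k x w) \<in> borel_measurable (borel \<Otimes>\<^sub>M cube_pair_measure)" for k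
    unfolding f_def by measurable
  have [measurable]: "X k \<in> borel_measurable borel" for k
    unfolding X_def by measurable
  have X_int: "(\<integral>\<^sup>+x. ennreal (r k powr (1 - p i)) * X k x \<partial>lborel) \<le> ennreal (K * \<rho> ^ k)" for k
  proof -
    have "(\<integral>\<^sup>+x. X k x \<partial>lborel) = (\<integral>\<^sup>+w. \<integral>\<^sup>+x. ennreal (\<bar>f k x w\<bar> powr p i) \<partial>lborel \<partial>cube_pair_measure)"
      unfolding X_def by (rule lborel_cube_pair.Fubini'[symmetric]) measurable
    also have "\<dots> \<le> ennreal ((C * (2 * side k i) powr \<sigma> i) powr p i)"
    proof (rule nn_integral_cube_pair_le)
      show "(\<lambda>w. \<integral>\<^sup>+x. ennreal (\<bar>f k x w\<bar> powr p i) \<partial>lborel) \<in> borel_measurable borel"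
        unfolding f_def by measurable
      fix y z :: "real^'n" assume "y \<in> cbox 0 1" "z \<in> cbox 0 1"
      then show "(\<integral>\<^sup>+x. ennreal (\<bar>f k x (y, z)\<bar> powr p i) \<partial>lborel) \<le> ennreal ((C * (2 * side k i) powr \<sigma> i) powr p i)"
        using pow_int_translate_diff[of "t k (y, z)" "2 * side k i" i "c k (y, z)"] t side(2)[of k i]
        by (simp add: pow_int_def f_def)
    qed
    also have "(C * (2 * side k i) powr \<sigma> i) powr p i = K * r k powr p i"
      by (simp add: powr_mult K_def r_def)
    finally have "ennreal (r k powr (1 - p i)) * (\<integral>\<^sup>+x. X k x \<partial>lborel) \<le> ennreal (r k powr (1 - p i)) * ennreal (K * r k powr p i)"
      by (intro mult_left_mono) auto
    also have "\<dots> = ennreal (K * (r k powr (1 - p i) * r k powr p i))"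
      by (simp add: K_def mult_ac flip: ennreal_mult)
    also have "r k powr (1 - p i) * r k powr p i = \<rho> ^ k"
      using r0[of k] by (simp add: r flip: powr_add)
    finally show ?thesis by (simp add: nn_integral_cmult)
  qed
  have "(\<integral>\<^sup>+x. (\<Sum>k. ennreal (r k powr (1 - p i)) * X k x) \<partial>lborel) = (\<Sum>k. \<integral>\<^sup>+x. ennreal (r k powr (1 - p i)) * X k x \<partial>lborel)"
    by (rule nn_integral_suminf) measurable
  also have "\<dots> \<le> (\<Sum>k. ennreal (K * \<rho> ^ k))"
    by (intro suminf_le X_int) auto
  also have "\<dots> = ennreal (\<Sum>k. K * \<rho> ^ k)"
    using \<rho> by (intro suminf_ennreal2) (auto simp: K_def)
  finally have "(\<integral>\<^sup>+x. (\<Sum>k. ennreal (r k powr (1 - p i)) * X k x) \<partial>lborel) \<noteq> \<infinity>"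
    by (auto simp: top_unique)
  then have "AE x in lborel. (\<Sum>k. ennreal (r k powr (1 - p i)) * X k x) \<noteq> \<infinity>"
    by (intro nn_integral_PInf_AE) auto
  then show ?thesis
  proof eventually_elim
    case (elim x)
    have X0: "(\<lambda>k. ennreal (r k powr (1 - p i)) * X k x) \<longlonglongrightarrow> 0"
    proof -
      define h where "h k = enn2real (ennreal (r k powr (1 - p i)) * X k x)" for k
      have "ennreal (r k powr (1 - p i)) * X k x \<noteq> \<infinity>" for k
        using elim ennreal_suminf_lessD[of "\<lambda>k. ennreal (r k powr (1 - p i)) * X k x" \<infinity> k] by (auto simp: less_top)
      then have h: "ennreal (r k powr (1 - p i)) * X k x = ennreal (h k)" for k
        by (simp add: h_def less_top)
      have "summable h"
        using elim unfolding h by (intro summable_suminf_not_top) (auto simp: h_def)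
      then have "(\<lambda>k. ennreal (h k)) \<longlonglongrightarrow> ennreal 0"
        by (intro tendsto_ennrealI summable_LIMSEQ_zero)
      then show ?thesis by (simp add: h)
    qed
    have R0: "(\<lambda>k. ennreal (r k)) \<longlonglongrightarrow> ennreal 0"
      unfolding r using \<rho> by (intro tendsto_ennrealI LIMSEQ_realpow_zero) auto
    have lim: "(\<lambda>k. ennreal (r k) + ennreal (r k powr (1 - p i)) * X k x) \<longlonglongrightarrow> 0"
      using tendsto_add[OF R0 X0] by simp
    show ?case
    proof (rule tendsto_sandwich[OF _ _ tendsto_const lim])
      show "\<forall>\<^sub>F k in sequentially. (\<integral>\<^sup>+w. ennreal \<bar>u (x + (c k w + t k w *\<^sub>R axis i 1)) - u (x + c k w)\<bar> \<partial>cube_pair_measure)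
         \<le> ennreal (r k) + ennreal (r k powr (1 - p i)) * X k x"
      proof (rule always_eventually, rule allI)
        fix k
        have "(\<integral>\<^sup>+w. ennreal \<bar>f k x w\<bar> \<partial>cube_pair_measure) \<le>
          (\<integral>\<^sup>+w. ennreal (r k) + ennreal (r k powr (1 - p i)) * ennreal (\<bar>f k x w\<bar> powr p i) \<partial>cube_pair_measure)"
          using abs_le_add_powr[OF p(1)[of i] r0[of k]] less_imp_le[OF r0[of k]]
          by (intro nn_integral_mono) (simp flip: ennreal_mult ennreal_plus)
        also have "\<dots> = ennreal (r k) + ennreal (r k powr (1 - p i)) * X k x"
          by (subst nn_integral_add) (auto simp: nn_integral_cmult X_def)
        finally show "(\<integral>\<^sup>+w. ennreal \<bar>u (x + (c k w + t k w *\<^sub>R axis i 1)) - u (x + c k w)\<bar> \<partial>cube_pair_measure)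
         \<le> ennreal (r k) + ennreal (r k powr (1 - p i)) * X k x"
          by (simp add: f_def)
      qed
    qed auto
  qed
qed

lemma AE_mean_tendsto: "AE x in lborel. (\<lambda>k. mean k x) \<longlonglongrightarrow> u x"
proof -
  note [measurable_cong] = sets_cube_pair_measure
  \<comment> \<open>The displacement of \<open>mean k\<close>, restricted to the coordinates in
    \<open>I\<close>. Both boxes have the same sides, so the variables enter through their sum, with
    coordinates between 0 and 2.\<close>
  define c where "c I k w = dilate (\<lambda>j. if j \<in> I then side k j else 0) (fst w + snd w)"
    for I k and w :: "(real^'n) \<times> (real^'n)"
  have c[measurable]: "c I k \<in> borel_measurable borel" for I k
    unfolding c_def by (intro measurable_compose[OF _ dilate_measurable] borel_measurable_continuous_onI continuous_intros)
  have "AE x in lborel. (\<lambda>k. \<integral>\<^sup>+w. ennreal \<bar>u (x + c I k w) - u x\<bar> \<partial>cube_pair_measure) \<longlonglongrightarrow> 0" for I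
    using finite[of I]
  proof (induction I)
    case empty
    have "c {} k w = 0" for k w by (simp add: c_def vec_eq_iff)
    then show ?case by simp
  next
    case (insert i I)
    define t where "t k w = side k i * (fst w + snd w) $ i" for k and w :: "(real^'n) \<times> (real^'n)"
    have t[measurable]: "t k \<in> borel_measurable borel" for k
      unfolding t_def by (intro borel_measurable_continuous_onI continuous_intros)
    have c_insert: "c (insert i I) k w = c I k w + t k w *\<^sub>R axis i 1" for k w
      using insert.hyps by (auto simp: c_def t_def vec_eq_iff axis_def)
    have t_le: "\<bar>t k (y, z)\<bar> \<le> 2 * side k i" if "y \<in> cbox 0 1" "z \<in> cbox 0 1" for k and y z :: "real^'n"
    proof -
      have "0 \<le> y $ i + z $ i" "y $ i + z $ i \<le> 2"
        using that by (auto simp: mem_box_cart intro: order_trans[OF add_mono[of _ 1 _ 1]])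
      then show ?thesis
        using side(1)[of k i] by (auto simp: t_def abs_mult)
    qed
    have "AE x in lborel. (\<lambda>k. \<integral>\<^sup>+w. ennreal \<bar>u (x + (c I k w + t k w *\<^sub>R axis i 1)) - u (x + c I k w)\<bar> \<partial>cube_pair_measure) \<longlonglongrightarrow> 0"
      by (rule AE_coordinate_difference_tendsto_0) (use t_le in auto)
    from this insert.IH
    show ?case
    proof eventually_elim
      case (elim x)
      show ?case
      proof (rule tendsto_sandwich[OF _ _ tendsto_const])
        show "(\<lambda>k. (\<integral>\<^sup>+w. ennreal \<bar>u (x + (c I k w + t k w *\<^sub>R axis i 1)) - u (x + c I k w)\<bar> \<partial>cube_pair_measure)
          + (\<integral>\<^sup>+w. ennreal \<bar>u (x + c I k w) - u x\<bar> \<partial>cube_pair_measure)) \<longlonglongrightarrow> 0"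
          using tendsto_add[OF elim] by simp
        show "\<forall>\<^sub>F k in sequentially. (\<integral>\<^sup>+w. ennreal \<bar>u (x + c (insert i I) k w) - u x\<bar> \<partial>cube_pair_measure) \<le>
          (\<integral>\<^sup>+w. ennreal \<bar>u (x + (c I k w + t k w *\<^sub>R axis i 1)) - u (x + c I k w)\<bar> \<partial>cube_pair_measure)
          + (\<integral>\<^sup>+w. ennreal \<bar>u (x + c I k w) - u x\<bar> \<partial>cube_pair_measure)"
        proof (rule always_eventually, rule allI)
          fix k
          have "(\<integral>\<^sup>+w. ennreal \<bar>u (x + c (insert i I) k w) - u x\<bar> \<partial>cube_pair_measure) \<le>
            (\<integral>\<^sup>+w. ennreal \<bar>u (x + (c I k w + t k w *\<^sub>R axis i 1)) - u (x + c I k w)\<bar>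
              + ennreal \<bar>u (x + c I k w) - u x\<bar> \<partial>cube_pair_measure)"
            unfolding c_insert by (intro nn_integral_mono) (simp flip: ennreal_plus)
          also have "\<dots> = (\<integral>\<^sup>+w. ennreal \<bar>u (x + (c I k w + t k w *\<^sub>R axis i 1)) - u (x + c I k w)\<bar> \<partial>cube_pair_measure)
          + (\<integral>\<^sup>+w. ennreal \<bar>u (x + c I k w) - u x\<bar> \<partial>cube_pair_measure)"
            by (rule nn_integral_add) measurable
          finally show "(\<integral>\<^sup>+w. ennreal \<bar>u (x + c (insert i I) k w) - u x\<bar> \<partial>cube_pair_measure) \<le> \<dots>" .
        qed
      qed auto
    qed
  qed
  from this[of UNIV] show ?thesis
  proof eventually_elim
    case (elim x)
    have cU: "x + dilate (side k) (snd w) + dilate (side k) (fst w) = x + c UNIV k w" for k w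
      by (simp add: c_def vec_eq_iff algebra_simps)
    have "(\<lambda>k. ennreal \<bar>mean k x - u x\<bar>) \<longlonglongrightarrow> 0"
    proof (rule tendsto_sandwich[OF _ _ tendsto_const elim])
      show "\<forall>\<^sub>F k in sequentially. ennreal \<bar>mean k x - u x\<bar> \<le> (\<integral>\<^sup>+w. ennreal \<bar>u (x + c UNIV k w) - u x\<bar> \<partial>cube_pair_measure)"
      proof (rule always_eventually, rule allI)
        fix k
        have int: "integrable cube_pair_measure (\<lambda>w. u (x + c UNIV k w))"
          using box_mean_integrable[where d="side k" and e="side k" and x=x, OF side(1)] by (simp add: cU)
        have "measure cube_pair_measure (space (cube_pair_measure :: ((real^'n) \<times> (real^'n)) measure)) = 1"
          by (simp only: measure_def emeasure_cube_pair_measure enn2real_1)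
        then have "mean k x - u x = (\<integral>w. u (x + c UNIV k w) - u x \<partial>cube_pair_measure)"
          using int by (simp add: mean_def box_mean_def cU)
        then show "ennreal \<bar>mean k x - u x\<bar> \<le> (\<integral>\<^sup>+w. ennreal \<bar>u (x + c UNIV k w) - u x\<bar> \<partial>cube_pair_measure)"
          using integral_norm_bound_ennreal[of cube_pair_measure "\<lambda>w. u (x + c UNIV k w) - u x"] int by simp
      qed
    qed auto
    then have "(\<lambda>k. \<bar>mean k x - u x\<bar>) \<longlonglongrightarrow> 0"
      using tendsto_ennreal_iff[of "\<lambda>k. \<bar>mean k x - u x\<bar>" sequentially 0] by simp
    then show ?case
      by (simp add: tendsto_rabs_zero_iff LIM_zero_iff)
  qed
qed

lemma mean_approximates:
  "pow_int q (\<lambda>x. u x - mean m x)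
    \<le> ennreal ((4 * real CARD('n) * C / (1 - 2 powr (- \<epsilon>)) * (2 powr (- \<epsilon>)) ^ m) powr q)"
proof (rule pow_int_telescope_limit[OF mean_measurable q _ _ _ mean_step u AE_mean_tendsto])
  show "2 powr (- \<epsilon>) < 1" using powr_less_mono[of "- \<epsilon>" 0 2] \<epsilon>(1) by simp
qed (use C in auto)

lemma mean_translate:
  assumes "\<And>i. \<bar>h $ i\<bar> \<le> 2"
  shows "\<bar>mean m (x + h) - mean m x\<bar> \<le> 2 powr (real m) * C * (\<Sum>i\<in>UNIV. \<bar>h $ i\<bar> powr \<sigma> i)"
proof -
  define c where "c I = (\<chi> j. if j \<in> I then h $ j else 0)" for I
  have "\<bar>mean m (x + c I) - mean m x\<bar> \<le> 2 powr (real m) * C * (\<Sum>i\<in>I. \<bar>h $ i\<bar> powr \<sigma> i)" for I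
    using finite[of I]
  proof (induction I)
    case empty
    have "c {} = 0" by (simp add: c_def vec_eq_iff)
    then show ?case by simp
  next
    case (insert i I)
    have "c (insert i I) = c I + h $ i *\<^sub>R axis i 1"
      using insert.hyps by (auto simp: c_def vec_eq_iff axis_def)
    then have "\<bar>mean m (x + c (insert i I)) - mean m (x + c I)\<bar> \<le> 2 powr (real m) * C * \<bar>h $ i\<bar> powr \<sigma> i"
      using mean_translate_coordinate[where t="h $ i" and i=i and m=m and x="x + c I", OF assms] by (simp add: add.assoc)
    with insert show ?case
      by (simp add: distrib_left)
  qed
  from this[of UNIV] show ?thesis by (simp add: c_def)
qed

end

subsection \<open>Compactness\<close>

lemma nikolskii_bound_equicontinuous:
  fixes u :: "'k \<Rightarrow> real^'n::finite \<Rightarrow> real"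
  assumes N: "\<And>k. nikolskii_bound (u k) p \<sigma> a q C \<epsilon>" and e: "0 < e"
  shows "\<exists>\<delta>>0. \<forall>k x y. dist x y < \<delta> \<longrightarrow> \<bar>nikolskii_bound.mean (u k) a m y - nikolskii_bound.mean (u k) a m x\<bar> < e"
proof -
  have \<sigma>: "0 < \<sigma> i" for i by (rule nikolskii_bound.\<sigma>[OF N])
  have "((\<lambda>h::real^'n. 2 powr (real m) * C * (\<Sum>i\<in>UNIV. \<bar>h $ i\<bar> powr \<sigma> i)) \<longlongrightarrow>
      2 powr (real m) * C * (\<Sum>i\<in>UNIV. \<bar>(0::real^'n) $ i\<bar> powr \<sigma> i)) (at 0)"
    using \<sigma> by (intro tendsto_intros tendsto_powr') auto
  then have "\<forall>\<^sub>F h in at (0::real^'n). 2 powr (real m) * C * (\<Sum>i\<in>UNIV. \<bar>h $ i\<bar> powr \<sigma> i) < e"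
    using e by (intro order_tendstoD(2)) auto
  then obtain d where d: "0 < d" "\<And>h::real^'n. h \<noteq> 0 \<Longrightarrow> norm h < d \<Longrightarrow> 2 powr (real m) * C * (\<Sum>i\<in>UNIV. \<bar>h $ i\<bar> powr \<sigma> i) < e"
    by (auto simp: eventually_at dist_norm)
  have "\<bar>nikolskii_bound.mean (u k) a m y - nikolskii_bound.mean (u k) a m x\<bar> < e"
    if "dist x y < min d 2" for k x y
  proof (cases "y - x = 0")
    case False
    have n: "norm (y - x) < min d 2" using that by (simp add: dist_norm norm_minus_commute)
    then have "\<bar>(y - x) $ i\<bar> \<le> 2" for i
      using component_le_norm_cart[of "y - x" i] by linarith
    then show ?thesis
      using nikolskii_bound.mean_translate[OF N, of "y - x" k m x] d(2)[of "y - x"] False n by simp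
  qed (use e in simp)
  then show ?thesis
    using d(1) by (intro exI[of _ "min d 2"]) auto
qed

text \<open>One selection on pairs of a scale and a point of a countable dense set serves all scales
  at once; equicontinuity at each fixed scale extends the convergence to every point.\<close>

lemma nikolskii_bound_diagonal:
  fixes u :: "nat \<Rightarrow> real^'n::finite \<Rightarrow> real"
  assumes N: "\<And>k. nikolskii_bound (u k) p \<sigma> a q C \<epsilon>"
  shows "\<exists>r. strict_mono r \<and> (\<forall>m x. convergent (\<lambda>k. nikolskii_bound.mean (u (r k)) a m x))"
proof -
  define A where "A k m x = nikolskii_bound.mean (u k) a m x" for k m x
  obtain D :: "(real^'n) set" where D: "countable D" "\<And>X. open X \<Longrightarrow> X \<noteq> {} \<Longrightarrow> \<exists>d\<in>D. d \<in> X"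
    using countable_dense_exists by blast
  \<comment> \<open>The selection needs one bound for all pairs, so each scale is divided by its own
    supremum bound; adding 1 keeps the divisor positive when \<open>C\<close> is 0.\<close>
  define b where "b m = 2 powr (real m / q) * C + 1" for m
  have C: "0 \<le> C" by (rule nikolskii_bound.C[OF N])
  have b: "0 < b m" for m using C by (simp add: b_def add_nonneg_pos)
  have "norm (A k (fst mx) (snd mx) / b (fst mx)) \<le> 1" for k mx
    using nikolskii_bound.mean_bounded[OF N, of k "fst mx" "snd mx"] b[of "fst mx"]
    by (simp add: A_def b_def)
  from function_convergent_subsequence[where f="\<lambda>k mx. A k (fst mx) (snd mx) / b (fst mx)" and S="UNIV \<times> D", OF _ this]
  obtain r where r: "strict_mono r"
    and lim: "\<And>mx. mx \<in> UNIV \<times> D \<Longrightarrow> \<exists>l. (\<lambda>k. A (r k) (fst mx) (snd mx) / b (fst mx)) \<longlonglongrightarrow> l"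
    using D(1) by auto
  have conv: "convergent (\<lambda>k. A (r k) m x)" if x: "x \<in> D" for m x
  proof -
    from lim[of "(m, x)"] x have "convergent (\<lambda>k. A (r k) m x / b m)"
      by (auto simp: convergent_def)
    from convergent_mult[OF convergent_const[of "b m"] this] show ?thesis
      using b[of m] by simp
  qed
  have "convergent (\<lambda>k. A (r k) m x)" for m x
  proof (rule Cauchy_convergent, rule metric_CauchyI)
    fix e :: real assume "0 < e"
    then obtain \<delta> where \<delta>: "0 < \<delta>" "\<And>k x y. dist x y < \<delta> \<Longrightarrow> \<bar>A k m y - A k m x\<bar> < e / 3"
      using nikolskii_bound_equicontinuous[where u=u and e="e / 3" and m=m, OF N] unfolding A_def by auto
    obtain y where y: "y \<in> D" "dist x y < \<delta>"
      using D(2)[of "ball x \<delta>"] \<delta>(1) by auto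
    from conv[OF y(1), of m] have "Cauchy (\<lambda>k. A (r k) m y)"
      by (rule convergent_Cauchy)
    then obtain M where M: "\<And>j k. M \<le> j \<Longrightarrow> M \<le> k \<Longrightarrow> dist (A (r j) m y) (A (r k) m y) < e / 3"
      using \<open>0 < e\<close> metric_CauchyD[of _ "e / 3"] by (metis divide_pos_pos zero_less_numeral)
    have "dist (A (r j) m x) (A (r k) m x) < e" if "M \<le> j" "M \<le> k" for j k
      using M[OF that] \<delta>(2)[OF y(2), of "r j"] \<delta>(2)[OF y(2), of "r k"] unfolding dist_real_def by linarith
    then show "\<exists>M. \<forall>j\<ge>M. \<forall>k\<ge>M. dist (A (r j) m x) (A (r k) m x) < e"
      by blast
  qed
  then show ?thesis
    using r by (auto simp: A_def)
qed

lemma abs_add3_powr_le: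
  fixes x y z q :: real
  assumes "0 \<le> q"
  shows "\<bar>x + y + z\<bar> powr q \<le> 3 powr q * (\<bar>x\<bar> powr q + \<bar>y\<bar> powr q + \<bar>z\<bar> powr q)"
proof -
  define M where "M = max \<bar>x\<bar> (max \<bar>y\<bar> \<bar>z\<bar>)"
  have "\<bar>x + y + z\<bar> powr q \<le> (3 * M) powr q"
    using assms by (intro powr_mono2) (auto simp: M_def)
  also have "\<dots> = 3 powr q * M powr q"
    by (rule powr_mult)
  also have "M powr q \<le> \<bar>x\<bar> powr q + \<bar>y\<bar> powr q + \<bar>z\<bar> powr q"
    unfolding M_def max_def by (auto intro: add_nonneg_nonneg)
  finally show ?thesis by simp
qed

lemma ennreal_tendsto_0I:
  fixes f :: "'a \<Rightarrow> ennreal"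
  assumes "\<And>e. 0 < e \<Longrightarrow> \<forall>\<^sub>F x in F. f x \<le> ennreal e"
  shows "(f \<longlongrightarrow> 0) F"
proof (rule order_tendstoI)
  fix c :: ennreal assume "0 < c"
  then obtain b where b: "0 < b" "b < c" using dense by blast
  then obtain e where e: "b = ennreal e" "0 < e"
    by (cases b) auto
  from assms[OF e(2)] show "\<forall>\<^sub>F x in F. f x < c"
    by eventually_elim (use b e in auto)
qed auto

theorem nikolskii_bound_precompact:
  fixes u :: "nat \<Rightarrow> real^'n::finite \<Rightarrow> real"
  assumes N: "\<And>k. nikolskii_bound (u k) p \<sigma> a q C \<epsilon>"
  shows "\<exists>r v. strict_mono r \<and> v \<in> borel_measurable borel \<and>
    (\<forall>K. compact K \<longrightarrow> (\<lambda>k. \<integral>\<^sup>+x\<in>K. ennreal (\<bar>u (r k) x - v x\<bar> powr q) \<partial>lborel) \<longlonglongrightarrow> 0)"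
proof -
  obtain r where r: "strict_mono r" and conv: "\<And>m x. convergent (\<lambda>k. nikolskii_bound.mean (u (r k)) a m x)"
    using nikolskii_bound_diagonal[where u=u, OF N] by auto
  define A where "A k m x = nikolskii_bound.mean (u (r k)) a m x" for k m x
  have u[measurable]: "u k \<in> borel_measurable borel" for k
    by (rule nikolskii_bound.u[OF N])
  have A[measurable]: "A k m \<in> borel_measurable borel" for k m
    unfolding A_def by (rule nikolskii_bound.mean_measurable[OF N])
  have q: "1 \<le> q" by (rule nikolskii_bound.q[OF N])
  have C: "0 \<le> C" by (rule nikolskii_bound.C[OF N])
  have \<epsilon>: "0 < \<epsilon>" by (rule nikolskii_bound.\<epsilon>(1)[OF N])
  define \<rho> where "\<rho> = 2 powr (- \<epsilon>)"
  have \<rho>: "0 < \<rho>" "\<rho> < 1"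
    using powr_less_mono[of "- \<epsilon>" 0 2] \<epsilon> by (auto simp: \<rho>_def)
  define L where "L = 4 * real CARD('n) * C"
  have L: "0 \<le> L" using C by (simp add: L_def)
  define w where "w m x = lim (\<lambda>k. A k m x)" for m x
  have w[measurable]: "w m \<in> borel_measurable borel" for m
    unfolding w_def by measurable
  have Aw: "(\<lambda>k. A k m x) \<longlonglongrightarrow> w m x" for m x
    using conv[of m x] by (simp add: w_def A_def convergent_LIMSEQ_iff)
  \<comment> \<open>The limits in k inherit the geometric steps by Fatou's lemma; hence they
    converge almost everywhere as the scale grows, and \<open>v\<close> is their limit.\<close>
  have w_step: "pow_int q (\<lambda>x. w (Suc m) x - w m x) \<le> ennreal ((L * \<rho> ^ m) powr q)" for m
  proof (rule pow_int_Fatou)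
    show "AE x in lborel. (\<lambda>k. A k (Suc m) x - A k m x) \<longlonglongrightarrow> w (Suc m) x - w m x"
      by (intro AE_I2 tendsto_intros Aw)
    show "\<forall>\<^sub>F k in sequentially. pow_int q (\<lambda>x. A k (Suc m) x - A k m x) \<le> ennreal ((L * \<rho> ^ m) powr q)"
      unfolding A_def L_def \<rho>_def
      using nikolskii_bound.mean_step[OF N] by (intro always_eventually) auto
  qed (use q in auto)
  define v where "v x = lim (\<lambda>m. w m x)" for x
  have v[measurable]: "v \<in> borel_measurable borel"
    unfolding v_def by measurable
  have wv: "AE x in lborel. (\<lambda>m. w m x) \<longlonglongrightarrow> v x"
    using pow_int_telescope_convergent[OF w q L \<rho> w_step]
    by eventually_elim (simp add: v_def convergent_LIMSEQ_iff)
  define \<eta> where "\<eta> m = (L / (1 - \<rho>) * \<rho> ^ m) powr q" for m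
  have vw: "pow_int q (\<lambda>x. v x - w m x) \<le> ennreal (\<eta> m)" for m
    unfolding \<eta>_def by (rule pow_int_telescope_limit[OF w q L \<rho> w_step v wv])
  have uA: "pow_int q (\<lambda>x. u (r k) x - A k m x) \<le> ennreal (\<eta> m)" for k m
    unfolding \<eta>_def L_def \<rho>_def A_def by (rule nikolskii_bound.mean_approximates[OF N])
  have \<eta>0: "\<eta> \<longlonglongrightarrow> 0"
  proof -
    have "(\<lambda>m. (L / (1 - \<rho>) * \<rho> ^ m) powr q) \<longlonglongrightarrow> (L / (1 - \<rho>) * 0) powr q"
      using q L \<rho> by (intro tendsto_powr' tendsto_intros LIMSEQ_realpow_zero) auto
    then show ?thesis using q by (simp add: \<eta>_def[abs_def])
  qed
  have "(\<lambda>k. \<integral>\<^sup>+x\<in>K. ennreal (\<bar>u (r k) x - v x\<bar> powr q) \<partial>lborel) \<longlonglongrightarrow> 0" if K: "compact K" for K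
  proof (rule ennreal_tendsto_0I)
    fix e :: real assume e: "0 < e"
    have [measurable]: "K \<in> sets borel" using K by (simp add: borel_compact)
    have K_fin: "emeasure lborel K < \<infinity>" using K by (rule emeasure_compact_finite)
    \<comment> \<open>Once \<open>3 powr q\<close> is multiplied out, the three error terms receive
      e / 4, e / 2 and e / 4.\<close>
    have pos: "0 < e / (4 * 3 powr q)" using e by simp
    then obtain m where m: "\<eta> m < e / (4 * 3 powr q)"
      using order_tendstoD(2)[OF \<eta>0 pos] by (auto simp: eventually_sequentially)
    define B where "B = 2 powr (real m / q) * C"
    have A_le: "\<bar>A k m x\<bar> \<le> B" for k x
      unfolding A_def B_def by (rule nikolskii_bound.mean_bounded[OF N])
    have w_le: "\<bar>w m x\<bar> \<le> B" for x
      by (rule LIMSEQ_le_const2[OF tendsto_rabs[OF Aw]]) (use A_le in auto)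
    define h where "h k x = ennreal (\<bar>A k m x - w m x\<bar> powr q) * indicator K x" for k x
    have [measurable]: "h k \<in> borel_measurable borel" for k
      unfolding h_def by measurable
    \<comment> \<open>At a fixed scale the averages and their limit are bounded by \<open>B\<close>,
      and \<open>K\<close> has finite measure; convergence at every point then suffices.\<close>
    have "(\<lambda>k. \<integral>\<^sup>+x. h k x \<partial>lborel) \<longlonglongrightarrow> (\<integral>\<^sup>+x. 0 \<partial>(lborel :: (real^'n) measure))"
    proof (rule nn_integral_dominated_convergence[where w="\<lambda>x. ennreal ((2 * B) powr q) * indicator K x"])
      show "AE x in lborel. h k x \<le> ennreal ((2 * B) powr q) * indicator K x" for k
      proof (rule AE_I2)
        fix x
        have "\<bar>A k m x - w m x\<bar> powr q \<le> (2 * B) powr q"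
          using A_le[of k x] w_le[of x] q by (intro powr_mono2) auto
        then show "h k x \<le> ennreal ((2 * B) powr q) * indicator K x"
          by (auto simp: h_def indicator_def)
      qed
      show "(\<integral>\<^sup>+x. ennreal ((2 * B) powr q) * indicator K x \<partial>lborel) < \<infinity>"
        using K_fin by (simp add: nn_integral_cmult_indicator ennreal_mult_less_top)
      show "AE x in lborel. (\<lambda>k. h k x) \<longlonglongrightarrow> 0"
      proof (rule AE_I2)
        fix x
        have "(\<lambda>k. \<bar>A k m x - w m x\<bar> powr q) \<longlonglongrightarrow> \<bar>w m x - w m x\<bar> powr q"
          using q by (intro tendsto_powr' tendsto_intros Aw) auto
        then have "(\<lambda>k. ennreal (\<bar>A k m x - w m x\<bar> powr q)) \<longlonglongrightarrow> ennreal 0"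
          using q by (intro tendsto_ennrealI) simp
        then show "(\<lambda>k. h k x) \<longlonglongrightarrow> 0"
          unfolding h_def by (cases "x \<in> K") auto
      qed
    qed measurable
    then have "\<forall>\<^sub>F k in sequentially. (\<integral>\<^sup>+x. h k x \<partial>lborel) < ennreal (e / (2 * 3 powr q))"
      using e by (intro order_tendstoD(2)) auto
    then show "\<forall>\<^sub>F k in sequentially. (\<integral>\<^sup>+x\<in>K. ennreal (\<bar>u (r k) x - v x\<bar> powr q) \<partial>lborel) \<le> ennreal e"
    proof eventually_elim
      case (elim k)
      have "(\<integral>\<^sup>+x\<in>K. ennreal (\<bar>u (r k) x - v x\<bar> powr q) \<partial>lborel) \<le>
        (\<integral>\<^sup>+x. ennreal (3 powr q) * ((ennreal (\<bar>u (r k) x - A k m x\<bar> powr q) + h k x) + ennreal (\<bar>v x - w m x\<bar> powr q)) \<partial>lborel)"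
      proof (rule nn_integral_mono)
        fix x
        have "\<bar>u (r k) x - v x\<bar> powr q \<le> 3 powr q * (\<bar>u (r k) x - A k m x\<bar> powr q + \<bar>A k m x - w m x\<bar> powr q + \<bar>v x - w m x\<bar> powr q)"
          using abs_add3_powr_le[of q "u (r k) x - A k m x" "A k m x - w m x" "w m x - v x"] q
          by (simp add: abs_minus_commute[of "v x"])
        then have "ennreal (\<bar>u (r k) x - v x\<bar> powr q) \<le> ennreal (3 powr q) * ((ennreal (\<bar>u (r k) x - A k m x\<bar> powr q)
           + ennreal (\<bar>A k m x - w m x\<bar> powr q)) + ennreal (\<bar>v x - w m x\<bar> powr q))"
          by (simp flip: ennreal_mult ennreal_plus)
        then show "ennreal (\<bar>u (r k) x - v x\<bar> powr q) * indicator K x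
          \<le> ennreal (3 powr q) * ((ennreal (\<bar>u (r k) x - A k m x\<bar> powr q) + h k x) + ennreal (\<bar>v x - w m x\<bar> powr q))"
          by (cases "x \<in> K") (auto simp: h_def)
      qed
      also have "\<dots> = ennreal (3 powr q) * ((pow_int q (\<lambda>x. u (r k) x - A k m x) + (\<integral>\<^sup>+x. h k x \<partial>lborel)) + pow_int q (\<lambda>x. v x - w m x))"
        by (simp add: nn_integral_cmult nn_integral_add pow_int_def)
      also have "\<dots> \<le> ennreal (3 powr q) * ((ennreal (\<eta> m) + ennreal (e / (2 * 3 powr q))) + ennreal (\<eta> m))"
        using elim by (intro mult_left_mono add_mono uA vw) auto
      also have "\<dots> = ennreal (3 powr q * (\<eta> m + e / (2 * 3 powr q) + \<eta> m))"
      proof -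
        have "0 \<le> \<eta> m" by (simp add: \<eta>_def)
        then show ?thesis using e by (simp flip: ennreal_mult ennreal_plus)
      qed
      also have "\<dots> \<le> ennreal (3 powr q * (e / (4 * 3 powr q) + e / (2 * 3 powr q) + e / (4 * 3 powr q)))"
        using m by (intro ennreal_leI mult_left_mono) auto
      also have "3 powr q * (e / (4 * 3 powr q) + e / (2 * 3 powr q) + e / (4 * 3 powr q)) = e"
        by (simp add: field_simps)
      finally show ?case .
    qed
  qed
  with r v show ?thesis by (intro exI[of _ r] exI[of _ v]) auto
qed

subsection \<open>The compactness theorem\<close>

lemma Lp_loc_convergesI:
  fixes f :: "nat \<Rightarrow> real^'n::finite \<Rightarrow> real"
  assumes f[measurable]: "\<And>m. f m \<in> borel_measurable borel" and v[measurable]: "v \<in> borel_measurable borel"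
    and q: "1 \<le> q" and fin: "\<And>m. pow_int q (f m) < \<infinity>"
    and lim: "\<And>K. compact K \<Longrightarrow> (\<lambda>m. \<integral>\<^sup>+x\<in>K. ennreal (\<bar>f m x - v x\<bar> powr q) \<partial>lborel) \<longlonglongrightarrow> 0"
  shows "Lp_loc_converges q f v"
proof -
  have main: "set_integrable lborel K (\<lambda>x. \<bar>v x\<bar> powr q) \<and>
        (\<forall>m. set_integrable lborel K (\<lambda>x. \<bar>f m x - v x\<bar> powr q)) \<and>
        ((\<lambda>m. (LINT x:K|lborel. \<bar>f m x - v x\<bar> powr q) powr (1 / q)) \<longlonglongrightarrow> 0)"
    if K: "compact K" for K
  proof -
    have [measurable]: "K \<in> sets borel" using K by (simp add: borel_compact)
    define I where "I g = (\<integral>\<^sup>+x\<in>K. ennreal (\<bar>g x\<bar> powr q) \<partial>lborel)" for g :: "real^'n \<Rightarrow> real"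
    have I_add: "I (\<lambda>x. g x + h x) < \<infinity>"
      if [measurable]: "g \<in> borel_measurable borel" "h \<in> borel_measurable borel" and "I g < \<infinity>" "I h < \<infinity>" for g h
    proof -
      have "I (\<lambda>x. g x + h x) \<le> (\<integral>\<^sup>+x. ennreal (2 powr (q - 1)) *
        (ennreal (\<bar>g x\<bar> powr q) * indicator K x + ennreal (\<bar>h x\<bar> powr q) * indicator K x) \<partial>lborel)"
        unfolding I_def
      proof (rule nn_integral_mono)
        fix x
        show "ennreal (\<bar>g x + h x\<bar> powr q) * indicator K x \<le> ennreal (2 powr (q - 1)) *
          (ennreal (\<bar>g x\<bar> powr q) * indicator K x + ennreal (\<bar>h x\<bar> powr q) * indicator K x)"
          using abs_add_powr_le[OF q, of "g x" "h x"]
          by (cases "x \<in> K") (simp_all flip: ennreal_mult ennreal_plus)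
      qed
      also have "\<dots> = ennreal (2 powr (q - 1)) * (I g + I h)"
        by (simp add: nn_integral_cmult nn_integral_add I_def)
      also have "\<dots> < \<infinity>"
        using that by (simp add: ennreal_mult_less_top)
      finally show ?thesis .
    qed
    have I_f: "I (f m) < \<infinity>" for m
    proof -
      have "I (f m) \<le> pow_int q (f m)"
        unfolding I_def pow_int_def by (intro nn_integral_mono) (auto simp: indicator_def)
      then show ?thesis using fin[of m] by (rule order_le_less_trans)
    qed
    have I_uminus: "I (\<lambda>x. - g x) = I g" for g by (simp add: I_def)
    have "\<forall>\<^sub>F m in sequentially. I (\<lambda>x. f m x - v x) < 1"
      using order_tendstoD(2)[OF lim[OF K], of 1] by (simp add: I_def)
    \<comment> \<open>Local integrability of \<open>v\<close> is not given; a single member of the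
      sequence at finite distance from \<open>v\<close> on \<open>K\<close> provides it.\<close>
    then obtain m where "I (\<lambda>x. f m x - v x) < 1"
      by (auto simp: eventually_sequentially)
    then have "I (\<lambda>x. - (f m x - v x)) < \<infinity>"
      unfolding I_uminus by (rule order_less_trans) simp
    from I_add[OF _ _ this I_f[of m]] have I_v: "I v < \<infinity>" by simp
    have I_fv: "I (\<lambda>x. f m x - v x) < \<infinity>" for m
      using I_add[of "f m" "\<lambda>x. - v x"] I_f[of m] I_v by (simp add: I_uminus)
    have eq: "(\<integral>\<^sup>+x. ennreal (indicat_real K x *\<^sub>R \<bar>g x\<bar> powr q) \<partial>lborel) = I g" for g
      unfolding I_def by (intro nn_integral_cong) (auto simp: indicator_def)
    have int: "set_integrable lborel K (\<lambda>x. \<bar>g x\<bar> powr q)"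
      if [measurable]: "g \<in> borel_measurable borel" and "I g < \<infinity>" for g
      unfolding set_integrable_def using that(2) eq[of g]
      by (intro integrableI_nonneg) auto
    have "(LINT x:K|lborel. \<bar>f m x - v x\<bar> powr q) = enn2real (I (\<lambda>x. f m x - v x))" for m
      unfolding set_lebesgue_integral_def eq[symmetric] by (rule integral_eq_nn_integral) auto
    moreover have "(\<lambda>m. enn2real (I (\<lambda>x. f m x - v x))) \<longlonglongrightarrow> enn2real 0"
      using lim[OF K] by (intro tendsto_enn2real) (auto simp: I_def)
    ultimately have "(\<lambda>m. LINT x:K|lborel. \<bar>f m x - v x\<bar> powr q) \<longlonglongrightarrow> 0"
      by simp
    then have "(\<lambda>m. (LINT x:K|lborel. \<bar>f m x - v x\<bar> powr q) powr (1 / q)) \<longlonglongrightarrow> 0 powr (1 / q)"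
      using q by (intro tendsto_powr' tendsto_const)
        (auto simp: set_lebesgue_integral_def intro!: always_eventually integral_nonneg_AE)
    then show ?thesis
      using int[OF v I_v] int[OF _ I_fv] by simp
  qed
  then show ?thesis
    by (simp add: Lp_loc_converges_def)
qed

text \<open>With S1 the sum of 1 / s i and S2 that of 1 / (s i * p i), the critical exponent is S1 /
  (S2 - 1), and the bound on \<open>sp_bar\<close> says S2 > 1. Clearing the denominator turns the
  strict inequality for \<open>q\<close> into S2 - S1 / q < 1.\<close>

lemma subcritical_condition:
  fixes p s :: "'n::finite \<Rightarrow> real"
  assumes p: "\<And>i. 0 < p i" and s: "\<And>i. 0 < s i" and q: "0 < q"
    and sub: "sp_bar s p < real CARD('n)" and lt: "q < p_star s p"
  shows "(\<Sum>i\<in>UNIV. 1 / s i * (1 / p i - 1 / q)) < 1"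
proof -
  define n where "n = real CARD('n)"
  define S1 where "S1 = (\<Sum>i\<in>UNIV. 1 / s i)"
  define S2 where "S2 = (\<Sum>i\<in>UNIV. 1 / (s i * p i))"
  have n: "0 < n" by (simp add: n_def)
  have S1: "0 < S1" unfolding S1_def by (intro sum_pos) (auto simp: s)
  have S2: "0 < S2" unfolding S2_def by (intro sum_pos) (auto simp: s p)
  have sb: "s_bar s = n / S1" by (simp add: s_bar_def n_def S1_def)
  have spb: "sp_bar s p = n / S2" by (simp add: sp_bar_def n_def S2_def)
  have S2_gt: "1 < S2"
    using sub n S2 by (simp add: spb n_def[symmetric] field_simps)
  have star: "p_star s p = S1 / (S2 - 1)"
    unfolding p_star_def sb spb n_def[symmetric] using n S1 S2 S2_gt by (simp add: field_simps)
  have "q * (S2 - 1) < S1"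
    using lt S2_gt unfolding star by (simp add: pos_less_divide_eq)
  then have "S2 - S1 / q < 1"
    using q by (simp add: field_simps)
  moreover have "(\<Sum>i\<in>UNIV. 1 / s i * (1 / p i - 1 / q)) = S2 - S1 / q"
    by (simp add: S1_def S2_def right_diff_distrib sum_subtractf sum_divide_distrib)
  ultimately show ?thesis by simp
qed

lemma pow_int_le_of_Lp_norm:
  assumes "in_Lp q u" "0 < q" "Lp_norm q u \<le> C"
  shows "pow_int q u \<le> ennreal (C powr q)"
proof -
  define I where "I = (\<integral>x. \<bar>u x\<bar> powr q \<partial>lborel)"
  have I: "0 \<le> I" by (simp add: I_def)
  have "pow_int q u = ennreal I"
    unfolding pow_int_def I_def using assms(1) by (intro nn_integral_eq_integral) (auto simp: in_Lp_def)
  moreover have "(I powr (1 / q)) powr q \<le> C powr q"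
    using assms by (intro powr_mono2) (auto simp: Lp_norm_def I_def)
  ultimately show ?thesis
    using I assms(2) by (simp add: powr_powr ennreal_leI)
qed

lemma J_frac_le_of_J_aniso:
  assumes "J_aniso s p u \<le> ennreal C" "0 < p i"
  shows "J_frac i (s i) (p i) u \<le> ennreal (p i * C)"
proof -
  have "ennreal (1 / p i) * J_frac i (s i) (p i) u \<le> J_aniso s p u"
    unfolding J_aniso_def by (rule member_le_sum) auto
  then have "ennreal (p i) * (ennreal (1 / p i) * J_frac i (s i) (p i) u) \<le> ennreal (p i) * ennreal C"
    using assms by (intro mult_left_mono) (auto intro: order_trans)
  then show ?thesis
    using assms(2) by (simp add: mult.assoc[symmetric] ennreal_mult'[symmetric])
qed

text \<open>Trades the order \<open>s\<close> for a fixed smaller \<open>\<sigma>\<close> with a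
  constant free of \<open>s\<close>. Rescaling to t / 2, which is at most 1, compares the two
  powers, and s < 1 gives t^s at most twice t^\<open>\<sigma>\<close>; hence the second factor
  \<open>2 powr p\<close>.\<close>

lemma pow_int_difference_le:
  fixes u :: "real^'n::finite \<Rightarrow> real" and t :: real
  assumes u: "u \<in> borel_measurable borel" and p: "1 \<le> p" and \<sigma>: "0 < \<sigma>" "\<sigma> \<le> s" and s: "s < 1"
    and J: "J_frac i s p u \<le> ennreal B" and B: "0 \<le> B" and t: "\<bar>t\<bar> \<le> 2"
  shows "pow_int p (\<lambda>x. u (x + t *\<^sub>R axis i 1) - u x)
    \<le> ennreal (((2 powr (p + 2) * p / \<sigma> * 2 powr p * B) powr (1 / p) * \<bar>t\<bar> powr \<sigma>) powr p)"
proof -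
  define \<Gamma> where "\<Gamma> = 2 powr (p + 2) * p / \<sigma> * 2 powr p * B"
  have \<Gamma>: "0 \<le> \<Gamma>" using p \<sigma> B by (simp add: \<Gamma>_def)
  have pos: "pow_int p (\<lambda>x. u (x + t *\<^sub>R axis i 1) - u x) \<le> ennreal (\<Gamma> * (t powr \<sigma>) powr p)"
    if t: "0 < t" "t \<le> 2" for t
  proof -
    have "(t / 2) powr s \<le> (t / 2) powr \<sigma>"
      using t \<sigma> by (intro powr_mono') auto
    moreover have "2 powr s \<le> 2 powr (1 + \<sigma>)"
      using s \<sigma> by simp
    ultimately have "2 powr s * (t / 2) powr s \<le> 2 powr (1 + \<sigma>) * (t / 2) powr \<sigma>"
      by (intro mult_mono) auto
    then have "t powr s \<le> 2 * t powr \<sigma>"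
      using t by (simp add: powr_divide powr_add)
    then have ts: "t powr (s * p) \<le> 2 powr p * (t powr \<sigma>) powr p"
      using p powr_mono2[of p "t powr s" "2 * t powr \<sigma>"] by (simp add: powr_powr powr_mult)
    have "pow_int p (\<lambda>x. u (x + t *\<^sub>R axis i 1) - u x) \<le> ennreal (2 powr (p + 2) * p / s * t powr (s * p)) * J_frac i s p u"
      using assms t by (intro J_frac_controls_difference) auto
    also have "\<dots> \<le> ennreal (2 powr (p + 2) * p / s * t powr (s * p)) * ennreal B"
      by (intro mult_left_mono J) auto
    also have "\<dots> = ennreal (2 powr (p + 2) * p / s * t powr (s * p) * B)"
      using p \<sigma> B by (simp flip: ennreal_mult)
    also have "\<dots> \<le> ennreal (2 powr (p + 2) * p / \<sigma> * (2 powr p * (t powr \<sigma>) powr p) * B)"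
      using p \<sigma> B ts by (intro ennreal_leI mult_right_mono mult_mono divide_left_mono) auto
    finally show ?thesis by (simp add: \<Gamma>_def mult_ac)
  qed
  have "pow_int p (\<lambda>x. u (x + t *\<^sub>R axis i 1) - u x) \<le> ennreal (\<Gamma> * (\<bar>t\<bar> powr \<sigma>) powr p)"
  proof -
    consider "t = 0" | "0 < t" | "t < 0" by linarith
    then show ?thesis
    proof cases
      case 3
      then show ?thesis
        using pos[of "- t"] t pow_int_difference_uminus[OF u, of p "(- t) *\<^sub>R axis i 1"] by simp
    qed (use pos[of t] t p in \<open>auto simp: pow_int_def\<close>)
  qed
  also have "\<Gamma> * (\<bar>t\<bar> powr \<sigma>) powr p = (\<Gamma> powr (1 / p) * \<bar>t\<bar> powr \<sigma>) powr p"
    using \<Gamma> p by (simp add: powr_mult powr_powr)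
  finally show ?thesis by (simp add: \<Gamma>_def)
qed

text \<open>The set \<open>S\<close> stands for the first j coordinates, as the index type carries
  no order. Every \<open>s k i\<close> is below 1, so only the fractional seminorm occurs along the
  sequence; the order 1 enters through \<open>s0\<close> in the conditions on the exponents.\<close>

theorem theorem3p3:
  fixes p :: "'n::finite \<Rightarrow> real"
    and S :: "'n set"
    and s :: "nat \<Rightarrow> 'n \<Rightarrow> real"
    and s0 :: "'n \<Rightarrow> real"
    and u :: "nat \<Rightarrow> real^'n \<Rightarrow> real"
  assumes p_gt1: "\<And>i. 1 < p i"
    and S_ne: "S \<noteq> {}"
    and s0_S: "\<And>i. i \<in> S \<Longrightarrow> s0 i = 1"
    and s0_notS: "\<And>i. i \<notin> S \<Longrightarrow> 0 < s0 i \<and> s0 i < 1"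
    and s_range: "\<And>k i. 0 < s k i \<and> s k i < 1"
    and s_fixed: "\<And>k i. i \<notin> S \<Longrightarrow> s k i = s0 i"
    and s_lim: "\<And>i. i \<in> S \<Longrightarrow> (\<lambda>k. s k i) \<longlonglongrightarrow> 1"
    and u_Lp: "\<And>k. in_Lp (p_min p) (u k) \<and> in_Lp (p_max p) (u k)"
    and u_bdd: "\<exists>C. \<forall>k. Lp_norm (p_max p) (u k) + Lp_norm (p_min p) (u k) \<le> C"
    and J_bdd: "\<exists>C::real. \<forall>k. J_aniso (s k) p (u k) \<le> ennreal C"
    and subcrit: "sp_bar s0 p < real CARD('n)"
    and pmax_lt: "p_max p < p_star s0 p"
  shows "\<exists>r v. strict_mono r \<and> Lp_loc_converges (p_max p) (\<lambda>m. u (r m)) v"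
proof -
  define q where "q = p_max p"
  have pq: "p i \<le> q" for i by (simp add: q_def p_max_def)
  have q: "1 < q" using p_gt1[of undefined] pq[of undefined] by linarith
  have s0: "0 < s0 i" "s0 i \<le> 1" for i
    using s0_S[of i] s0_notS[of i] by (cases "i \<in> S"; force)+
  define D where "D = (\<Sum>i\<in>UNIV. 1 / s0 i * (1 / p i - 1 / q))"
  have gap: "0 \<le> 1 / p i - 1 / q" for i
    using p_gt1[of i] pq[of i] by (simp add: frac_le)
  have D: "0 \<le> D" "D < 1"
  proof -
    show "0 \<le> D" unfolding D_def using s0(1) gap by (intro sum_nonneg mult_nonneg_nonneg) (auto intro: less_imp_le)
    have "0 < p i" for i using p_gt1[of i] by simp
    then show "D < 1"
      unfolding D_def using q subcrit pmax_lt s0 by (intro subcritical_condition) (auto simp: q_def)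
  qed
  \<comment> \<open>Scaling all orders by \<open>\<theta>\<close> divides the sum \<open>D\<close>
    by \<open>\<theta>\<close>. The midpoint of \<open>D\<close> and 1 keeps the quotient below 1
    and stays positive even when \<open>D\<close> is 0.\<close>
  define \<theta> where "\<theta> = (1 + D) / 2"
  have \<theta>: "0 < \<theta>" "\<theta> < 1" "D < \<theta>" using D by (auto simp: \<theta>_def)
  define \<sigma> where "\<sigma> i = \<theta> * s0 i" for i
  have \<sigma>: "0 < \<sigma> i" for i using \<theta> s0 by (simp add: \<sigma>_def)
  have "\<forall>\<^sub>F k in sequentially. \<sigma> i \<le> s k i" for i
  proof (cases "i \<in> S")
    case True
    then have "\<forall>\<^sub>F k in sequentially. \<sigma> i < s k i"
      using \<theta> s0_S by (intro order_tendstoD(1)[OF s_lim]) (auto simp: \<sigma>_def)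
    then show ?thesis by eventually_elim simp
  next
    case False
    then show ?thesis using \<theta> s0(1)[of i] by (simp add: s_fixed \<sigma>_def)
  qed
  then have "\<forall>\<^sub>F k in sequentially. \<forall>i. \<sigma> i \<le> s k i"
    by (simp add: eventually_all_finite)
  \<comment> \<open>Orders in \<open>S\<close> tend to 1, which exceeds \<open>\<theta>\<close>, and
    the others are fixed above \<open>\<sigma> i\<close>. The sequence is later shifted by
    \<open>k0\<close>.\<close>
  then obtain k0 where k0: "\<And>k i. k0 \<le> k \<Longrightarrow> \<sigma> i \<le> s k i"
    by (auto simp: eventually_sequentially)
  define n where "n = real CARD('n)"
  have n: "0 < n" by (simp add: n_def)
  define g where "g i = 1 / \<sigma> i * (1 / p i - 1 / q)" for i
  define G where "G = (\<Sum>i\<in>UNIV. g i)"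
  have "G = D / \<theta>"
    by (simp add: G_def g_def D_def \<sigma>_def sum_divide_distrib mult.commute)
  then have G: "G < 1" using \<theta> by simp
  have g: "0 \<le> g i" for i unfolding g_def using \<sigma>[of i] gap[of i] by simp
  \<comment> \<open>The box of volume \<open>2 powr (- m)\<close> gets the sides \<open>2 powr (- m * a i)\<close>. Summability of the
    steps needs \<open>a i > g i\<close> for all \<open>i\<close>, which is compatible with \<open>sum a UNIV = 1\<close> because \<open>G < 1\<close>.\<close>
  define a where "a i = g i + (1 - G) / n" for i
  \<comment> \<open>Since \<open>g i * \<sigma> i\<close> equals 1 / p i - 1 / q, the surplus in
    direction \<open>i\<close> is \<open>(1 - G) / n * \<sigma> i\<close>; the minimum makes it
    independent of \<open>i\<close>.\<close>
  define \<epsilon> where "\<epsilon> = (1 - G) / n * Min (range \<sigma>)"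
  have a_pos: "0 < a i" for i using g[of i] G n by (simp add: a_def add_nonneg_pos)
  have a_sum: "(\<Sum>i\<in>UNIV. a i) = 1"
    using n by (simp add: a_def sum.distrib G_def[symmetric] n_def[symmetric])
  have \<epsilon>_pos: "0 < \<epsilon>" unfolding \<epsilon>_def using G n \<sigma> by simp
  have \<epsilon>_le: "\<epsilon> \<le> a i * \<sigma> i - (1 / p i - 1 / q)" for i
  proof -
    have "\<epsilon> \<le> (1 - G) / n * \<sigma> i"
      unfolding \<epsilon>_def using G n by (intro mult_left_mono) auto
    also have "\<dots> = a i * \<sigma> i - (1 / p i - 1 / q)"
      using \<sigma>[of i] by (simp add: a_def g_def distrib_right)
    finally show ?thesis .
  qed
  obtain C1 where C1: "\<And>k. Lp_norm q (u k) + Lp_norm (p_min p) (u k) \<le> C1"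
    using u_bdd by (auto simp: q_def)
  have norm_le: "Lp_norm q (u k) \<le> C1" for k
  proof -
    have "0 \<le> Lp_norm (p_min p) (u k)" by (simp add: Lp_norm_def)
    with C1[of k] show ?thesis by linarith
  qed
  obtain C2' where "\<And>k. J_aniso (s k) p (u k) \<le> ennreal C2'"
    using J_bdd by blast
  \<comment> \<open>\<open>ennreal\<close> sends negative reals to 0, so the real bound may be taken
    nonnegative.\<close>
  then have C2: "J_aniso (s k) p (u k) \<le> ennreal (max C2' 0)" for k
    by (rule order_trans) (simp add: ennreal_leI)
  define C2 where "C2 = max C2' 0"
  define \<gamma> where "\<gamma> i = (2 powr (p i + 2) * p i / \<sigma> i * 2 powr p i * (p i * C2)) powr (1 / p i)" for i
  define C where "C = C1 + (\<Sum>i\<in>UNIV. \<gamma> i)"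
  have \<gamma>: "0 \<le> \<gamma> i" for i by (simp add: \<gamma>_def)
  have C1_nonneg: "0 \<le> C1" using norm_le[of 0] by (rule order_trans[rotated]) (simp add: Lp_norm_def)
  have C: "0 \<le> C" "C1 \<le> C" "\<gamma> i \<le> C" for i
    using C1_nonneg member_le_sum[of i UNIV \<gamma>] \<gamma> sum_nonneg[of UNIV \<gamma>] by (auto simp: C_def)
  have u_meas: "u k \<in> borel_measurable borel" for k
    using u_Lp[of k] by (simp add: in_Lp_def)
  have u_pow: "pow_int q (u k) \<le> ennreal (C powr q)" for k
    using u_Lp[of k] q norm_le[of k] C by (intro pow_int_le_of_Lp_norm) (auto simp: q_def)
  have "nikolskii_bound (u (k + k0)) p \<sigma> a q C \<epsilon>" for k
  proof
    fix i and t :: real assume t: "\<bar>t\<bar> \<le> 2"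
    have "pow_int (p i) (\<lambda>x. u (k + k0) (x + t *\<^sub>R axis i 1) - u (k + k0) x) \<le> ennreal ((\<gamma> i * \<bar>t\<bar> powr \<sigma> i) powr p i)"
      unfolding \<gamma>_def
    proof (rule pow_int_difference_le[OF u_meas _ \<sigma> _ _ _ _ t])
      show "J_frac i (s (k + k0) i) (p i) (u (k + k0)) \<le> ennreal (p i * C2)"
        using C2[of "k + k0"] p_gt1[of i] by (intro J_frac_le_of_J_aniso) (auto simp: C2_def)
    qed (use p_gt1[of i] k0[of "k + k0" i] s_range[of "k + k0" i] in \<open>auto simp: C2_def\<close>)
    also have "\<dots> \<le> ennreal ((C * \<bar>t\<bar> powr \<sigma> i) powr p i)"
      using C \<gamma>[of i] p_gt1[of i] by (intro ennreal_leI powr_mono2 mult_right_mono) auto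
    finally show "pow_int (p i) (\<lambda>x. u (k + k0) (x + t *\<^sub>R axis i 1) - u (k + k0) x) \<le> ennreal ((C * \<bar>t\<bar> powr \<sigma> i) powr p i)" .
  qed (use u_meas p_gt1 pq \<sigma> C a_pos a_sum \<epsilon>_pos \<epsilon>_le u_pow in \<open>auto intro: less_imp_le\<close>)
  from nikolskii_bound_precompact[where u="\<lambda>k. u (k + k0)", OF this]
  obtain r v where r: "strict_mono r" and v: "v \<in> borel_measurable borel"
    and lim: "\<And>K. compact K \<Longrightarrow> (\<lambda>k. \<integral>\<^sup>+x\<in>K. ennreal (\<bar>u (r k + k0) x - v x\<bar> powr q) \<partial>lborel) \<longlonglongrightarrow> 0"
    by auto
  have "pow_int q (u k) < \<infinity>" for k
    using order_le_less_trans[OF u_pow ennreal_less_top] by simp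
  then have "Lp_loc_converges q (\<lambda>m. u (r m + k0)) v"
    using u_meas v q lim by (intro Lp_loc_convergesI) auto
  moreover have "strict_mono (\<lambda>m. r m + k0)"
    using r by (simp add: strict_mono_def)
  ultimately show ?thesis
    unfolding q_def by (intro exI[of _ "\<lambda>m. r m + k0"] exI[of _ v]) auto
qed

end
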